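(* Let $\Omega\subset\mathbb{C}$ be a bounded simply connected domain whose boundary $\Gamma=\partial\Omega$ is a Liapunov curve, and let $a,b\in L_\infty(\Omega;\mathbb{B})$. Then the following orthogonal decomposition holds: $$L_2(\Omega;\mathbb{B})=\mathcal{A}_{(a,b)}^2(\Omega;\mathbb{B})\oplus\overline{\left(\boldsymbol{\partial}+a^{\dagger}+b^*\mathbf{C}_{\mathbb{B}}\right)W_0^{1,2}(\Omega;\mathbb{B})}^{\,L_2(\Omega;\mathbb{B})}.$$
   Context: $\mathbb{B}=\{u+\mathbf{j}v : u,v\in\mathbb{C}\}$ is the commutative $\mathbb{C}$-algebra of bicomplex numbers, with $\mathbf{j}^2=-1$ and $i\mathbf{j}=\mathbf{j}i$. With $^*$ the complex conjugation on $\mathbb{C}$, for $W=u+\mathbf{j}v$: $\operatorname{Sc}W=u$, $\operatorname{Vec}W=v$, $\overline{W}=u-\mathbf{j}v$, $W^\dagger=u^*-\mathbf{j}v^*$, and for the coefficient $b$, $b^*:=(\operatorname{Sc}b)^*+\mathbf{j}(\operatorname{Vec}b)^*$. $\mathbf{C}_{\mathbb{B}}W=\overline{W}$. $\langle W,V\rangle_{\mathbb{B}}=(\operatorname{Sc}W)(\operatorname{Sc}V)^*+(\operatorname{Vec}W)(\operatorname{Vec}V)^*$. A function $F:\Omega\to\mathbb{B}$ belongs to $\mathscr{F}(\Omega;\mathbb{B})$ (for a space $\mathscr{F}(\Omega)$ of complex-valued functions) iff $\operatorname{Sc}F,\operatorname{Vec}F\in\mathscr{F}(\Omega)$. $L_2(\Omega;\mathbb{B})$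 is a complex Hilbert space with $\langle F,G\rangle=\iint_\Omega\langle F(z),G(z)\rangle_{\mathbb{B}}\,dA_z$. With $z=x+iy$: $\boldsymbol{\partial}=\frac12\left(\frac{\partial}{\partial x}-\mathbf{j}\frac{\partial}{\partial y}\right)$, $\overline{\boldsymbol{\partial}}=\frac12\left(\frac{\partial}{\partial x}+\mathbf{j}\frac{\partial}{\partial y}\right)$. A function $V\in L_{1,loc}(\Omega;\mathbb{B})$ is the weak $\overline{\boldsymbol{\partial}}$-derivative of $W$ if $\iint_\Omega W\,\overline{\boldsymbol{\partial}}\phi\,dA=-\iint_\Omega V\phi\,dA$ for all $\phi\in C_0^\infty(\Omega;\mathbb{B})$; similarly for $\boldsymbol{\partial}$. $\mathcal{A}_{(a,b)}^2(\Omega;\mathbb{B})$ is the set of all weak solutions $W\in L_2(\Omega;\mathbb{B})$ of $\overline{\boldsymbol{\partial}}W=aW+b\overline{W}$ in $\Omega$. A closed Jordan curve $\Gamma$ is a Liapunov curve if it is of class $C^1$ and the angle between the tangent to $\Gamma$ at $z\in\Gamma$ and the positive real axis is a Hölder continuous function of $z$. *)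

theory Defs
  imports "HOL-Analysis.Analysis"
begin

section \<open>Bicomplex numbers\<close>

datatype bicomplex = Bicomplex (Sc: complex) (Vec: complex)

lemma bicomplex_eq_iff: "W = V \<longleftrightarrow> Sc W = Sc V \<and> Vec W = Vec V"
  by (cases W; cases V) auto

instantiation bicomplex :: comm_ring_1
begin

definition "0 = Bicomplex 0 0"
definition "1 = Bicomplex 1 0"
definition "W + V = Bicomplex (Sc W + Sc V) (Vec W + Vec V)"
definition "W - V = Bicomplex (Sc W - Sc V) (Vec W - Vec V)"
definition "- W = Bicomplex (- Sc W) (- Vec W)"
definition "W * V = Bicomplex (Sc W * Sc V - Vec W * Vec V) (Sc W * Vec V + Vec W * Sc V)"

instance
  by standard
     (auto simp: zero_bicomplex_def one_bicomplex_def plus_bicomplex_def minus_bicomplex_def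
        uminus_bicomplex_def times_bicomplex_def algebra_simps)

end

definition bc_of_complex :: "complex \<Rightarrow> bicomplex" where
  "bc_of_complex c = Bicomplex c 0"

definition bc_j :: bicomplex where
  "bc_j = Bicomplex 0 1"

lemma bc_j_squared: "bc_j * bc_j = - 1"
  by (simp add: bc_j_def times_bicomplex_def uminus_bicomplex_def one_bicomplex_def)

lemma bicomplex_decompose: "W = bc_of_complex (Sc W) + bc_j * bc_of_complex (Vec W)"
  by (simp add: bicomplex_eq_iff bc_j_def bc_of_complex_def times_bicomplex_def plus_bicomplex_def)

text \<open>The three conjugations: \<open>bc_bar\<close> negates \<open>j\<close> and is complex-linear (this is the
  operator \<open>C\<^sub>B\<close>), \<open>bc_star\<close> conjugates both complex components, and \<open>bc_dagger\<close> does both.\<close>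

definition bc_bar :: "bicomplex \<Rightarrow> bicomplex" where
  "bc_bar W = Bicomplex (Sc W) (- Vec W)"

definition bc_star :: "bicomplex \<Rightarrow> bicomplex" where
  "bc_star W = Bicomplex (cnj (Sc W)) (cnj (Vec W))"

definition bc_dagger :: "bicomplex \<Rightarrow> bicomplex" where
  "bc_dagger W = Bicomplex (cnj (Sc W)) (- cnj (Vec W))"

definition bc_inner :: "bicomplex \<Rightarrow> bicomplex \<Rightarrow> complex" where
  "bc_inner W V = Sc W * cnj (Sc V) + Vec W * cnj (Vec V)"

definition bc_components_in :: "(complex \<Rightarrow> complex) set \<Rightarrow> (complex \<Rightarrow> bicomplex) set" where
  "bc_components_in S = {F. (\<lambda>z. Sc (F z)) \<in> S \<and> (\<lambda>z. Vec (F z)) \<in> S}"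

definition bc_integral :: "complex set \<Rightarrow> (complex \<Rightarrow> bicomplex) \<Rightarrow> bicomplex" where
  "bc_integral \<Omega> F =
     Bicomplex (LINT z|lebesgue_on \<Omega>. Sc (F z)) (LINT z|lebesgue_on \<Omega>. Vec (F z))"


section \<open>Function spaces on a plane set\<close>

text \<open>Functions on \<open>\<Omega>\<close> are represented by total functions on the plane; only the values on \<open>\<Omega>\<close>
  matter, and elements of Lebesgue spaces are representatives, compared almost everywhere on
  \<open>\<Omega>\<close>.\<close>

definition L2_fun :: "complex set \<Rightarrow> (complex \<Rightarrow> complex) set" where
  "L2_fun \<Omega> = {f \<in> borel_measurable (lebesgue_on \<Omega>).
     integrable (lebesgue_on \<Omega>) (\<lambda>z. (cmod (f z))\<^sup>2)}"

definition Linf_fun :: "complex set \<Rightarrow> (complex \<Rightarrow> complex) set" where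
  "Linf_fun \<Omega> = {f \<in> borel_measurable (lebesgue_on \<Omega>).
     \<exists>C. AE z in lebesgue_on \<Omega>. cmod (f z) \<le> C}"

definition L1loc_fun :: "complex set \<Rightarrow> (complex \<Rightarrow> complex) set" where
  "L1loc_fun \<Omega> = {f. \<forall>K. compact K \<and> K \<subseteq> \<Omega> \<longrightarrow> integrable (lebesgue_on K) f}"

definition L2_norm_fun :: "complex set \<Rightarrow> (complex \<Rightarrow> complex) \<Rightarrow> real" where
  "L2_norm_fun \<Omega> f = sqrt (LINT z|lebesgue_on \<Omega>. (cmod (f z))\<^sup>2)"

text \<open>Classical derivative in the real direction \<open>v\<close>: \<open>v = 1\<close> gives the derivative in \<open>x\<close>, and
  \<open>v = \<i>\<close> the derivative in \<open>y\<close>.\<close>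

definition pderiv_dir :: "complex \<Rightarrow> (complex \<Rightarrow> complex) \<Rightarrow> complex \<Rightarrow> complex" where
  "pderiv_dir v f z = frechet_derivative f (at z) v"

primrec C_k :: "nat \<Rightarrow> (complex \<Rightarrow> complex) \<Rightarrow> bool" where
  "C_k 0 f \<longleftrightarrow> continuous_on UNIV f"
| "C_k (Suc k) f \<longleftrightarrow>
     f differentiable_on UNIV \<and> C_k k (pderiv_dir 1 f) \<and> C_k k (pderiv_dir \<i> f)"

definition test_fun :: "complex set \<Rightarrow> (complex \<Rightarrow> complex) set" where
  "test_fun \<Omega> = {\<phi>. (\<forall>k. C_k k \<phi>) \<and> (\<exists>K. compact K \<and> K \<subseteq> \<Omega> \<and> (\<forall>z. z \<notin> K \<longrightarrow> \<phi> z = 0))}"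

definition weak_pderiv_dir ::
    "complex \<Rightarrow> complex set \<Rightarrow> (complex \<Rightarrow> complex) \<Rightarrow> (complex \<Rightarrow> complex) \<Rightarrow> bool" where
  "weak_pderiv_dir v \<Omega> f g \<longleftrightarrow> g \<in> L1loc_fun \<Omega> \<and>
     (\<forall>\<phi>\<in>test_fun \<Omega>. (LINT z|lebesgue_on \<Omega>. f z * pderiv_dir v \<phi> z)
                     = - (LINT z|lebesgue_on \<Omega>. g z * \<phi> z))"

text \<open>The closure of the test functions in the Sobolev space \<open>W\<^sup>1\<^sup>,\<^sup>2\<close> of \<open>\<Omega>\<close>; \<open>fx\<close> and \<open>fy\<close> are the
  weak partial derivatives of \<open>f\<close>.\<close>

definition W012_fun :: "complex set \<Rightarrow> (complex \<Rightarrow> complex) set" where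
  "W012_fun \<Omega> = {f \<in> L2_fun \<Omega>. \<exists>fx\<in>L2_fun \<Omega>. \<exists>fy\<in>L2_fun \<Omega>.
     weak_pderiv_dir 1 \<Omega> f fx \<and> weak_pderiv_dir \<i> \<Omega> f fy \<and>
     (\<exists>\<phi>. (\<forall>n::nat. \<phi> n \<in> test_fun \<Omega>) \<and>
        (\<lambda>n. L2_norm_fun \<Omega> (\<lambda>z. \<phi> n z - f z)) \<longlonglongrightarrow> 0 \<and>
        (\<lambda>n. L2_norm_fun \<Omega> (\<lambda>z. pderiv_dir 1 (\<phi> n) z - fx z)) \<longlonglongrightarrow> 0 \<and>
        (\<lambda>n. L2_norm_fun \<Omega> (\<lambda>z. pderiv_dir \<i> (\<phi> n) z - fy z)) \<longlonglongrightarrow> 0)}"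

definition bc_L2_inner ::
    "complex set \<Rightarrow> (complex \<Rightarrow> bicomplex) \<Rightarrow> (complex \<Rightarrow> bicomplex) \<Rightarrow> complex" where
  "bc_L2_inner \<Omega> F G = (LINT z|lebesgue_on \<Omega>. bc_inner (F z) (G z))"

definition bc_L2_norm :: "complex set \<Rightarrow> (complex \<Rightarrow> bicomplex) \<Rightarrow> real" where
  "bc_L2_norm \<Omega> F = sqrt (Re (bc_L2_inner \<Omega> F F))"

definition bc_L2_closure ::
    "complex set \<Rightarrow> (complex \<Rightarrow> bicomplex) set \<Rightarrow> (complex \<Rightarrow> bicomplex) set" where
  "bc_L2_closure \<Omega> S = {F \<in> bc_components_in (L2_fun \<Omega>).
     \<forall>e>0. \<exists>G\<in>S. bc_L2_norm \<Omega> (\<lambda>z. F z - G z) < e}"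

definition bc_L2_subspace :: "complex set \<Rightarrow> (complex \<Rightarrow> bicomplex) set \<Rightarrow> bool" where
  "bc_L2_subspace \<Omega> M \<longleftrightarrow> M \<subseteq> bc_components_in (L2_fun \<Omega>) \<and> (\<lambda>z. 0) \<in> M \<and>
     (\<forall>F\<in>M. \<forall>G\<in>M. (\<lambda>z. F z + G z) \<in> M) \<and>
     (\<forall>c. \<forall>F\<in>M. (\<lambda>z. bc_of_complex c * F z) \<in> M)"

text \<open>The space \<open>L\<^sub>2\<close> of bicomplex functions is the orthogonal sum of the subspaces \<open>M\<close> and \<open>N\<close>.
  Orthogonality makes the two summands unique up to null sets.\<close>

definition bc_L2_orthogonal_decomposition ::
    "complex set \<Rightarrow> (complex \<Rightarrow> bicomplex) set \<Rightarrow> (complex \<Rightarrow> bicomplex) set \<Rightarrow> bool" where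
  "bc_L2_orthogonal_decomposition \<Omega> M N \<longleftrightarrow>
     bc_L2_subspace \<Omega> M \<and> bc_L2_subspace \<Omega> N \<and>
     (\<forall>F\<in>M. \<forall>G\<in>N. bc_L2_inner \<Omega> F G = 0) \<and>
     (\<forall>F\<in>bc_components_in (L2_fun \<Omega>). \<exists>G\<in>M. \<exists>H\<in>N.
        AE z in lebesgue_on \<Omega>. F z = G z + H z)"


section \<open>Bicomplex Cauchy--Riemann operators and the Vekua equation\<close>

definition bc_pderiv_dir :: "complex \<Rightarrow> (complex \<Rightarrow> bicomplex) \<Rightarrow> complex \<Rightarrow> bicomplex" where
  "bc_pderiv_dir v F z =
     Bicomplex (pderiv_dir v (\<lambda>w. Sc (F w)) z) (pderiv_dir v (\<lambda>w. Vec (F w)) z)"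

definition bc_d :: "(complex \<Rightarrow> bicomplex) \<Rightarrow> complex \<Rightarrow> bicomplex" where
  "bc_d F z = bc_of_complex (1/2) * (bc_pderiv_dir 1 F z - bc_j * bc_pderiv_dir \<i> F z)"

definition bc_dbar :: "(complex \<Rightarrow> bicomplex) \<Rightarrow> complex \<Rightarrow> bicomplex" where
  "bc_dbar F z = bc_of_complex (1/2) * (bc_pderiv_dir 1 F z + bc_j * bc_pderiv_dir \<i> F z)"

definition weak_bc_d ::
    "complex set \<Rightarrow> (complex \<Rightarrow> bicomplex) \<Rightarrow> (complex \<Rightarrow> bicomplex) \<Rightarrow> bool" where
  "weak_bc_d \<Omega> W V \<longleftrightarrow> V \<in> bc_components_in (L1loc_fun \<Omega>) \<and>
     (\<forall>\<phi>\<in>bc_components_in (test_fun \<Omega>).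
        bc_integral \<Omega> (\<lambda>z. W z * bc_d \<phi> z) = - bc_integral \<Omega> (\<lambda>z. V z * \<phi> z))"

definition weak_bc_dbar ::
    "complex set \<Rightarrow> (complex \<Rightarrow> bicomplex) \<Rightarrow> (complex \<Rightarrow> bicomplex) \<Rightarrow> bool" where
  "weak_bc_dbar \<Omega> W V \<longleftrightarrow> V \<in> bc_components_in (L1loc_fun \<Omega>) \<and>
     (\<forall>\<phi>\<in>bc_components_in (test_fun \<Omega>).
        bc_integral \<Omega> (\<lambda>z. W z * bc_dbar \<phi> z) = - bc_integral \<Omega> (\<lambda>z. V z * \<phi> z))"

definition vekua_bergman ::
    "complex set \<Rightarrow> (complex \<Rightarrow> bicomplex) \<Rightarrow> (complex \<Rightarrow> bicomplex) \<Rightarrow> (complex \<Rightarrow> bicomplex) set" where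
  "vekua_bergman \<Omega> a b = {W \<in> bc_components_in (L2_fun \<Omega>).
     weak_bc_dbar \<Omega> W (\<lambda>z. a z * W z + b z * bc_bar (W z))}"

text \<open>The image of \<open>W\<^sub>0\<^sup>1\<^sup>,\<^sup>2\<close> under \<open>\<partial> + a\<^sup>\<dagger> + b\<^sup>* C\<^sub>B\<close>. The weak derivative \<open>D\<close> of
  \<open>\<Phi>\<close> is determined up to a null set; asking for it in \<open>L\<^sub>2\<close> is no restriction, because the
  weak partial derivatives of \<open>\<Phi>\<close> are in \<open>L\<^sub>2\<close>.\<close>

definition vekua_adjoint_range ::
    "complex set \<Rightarrow> (complex \<Rightarrow> bicomplex) \<Rightarrow> (complex \<Rightarrow> bicomplex) \<Rightarrow> (complex \<Rightarrow> bicomplex) set" where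
  "vekua_adjoint_range \<Omega> a b =
     {(\<lambda>z. D z + bc_dagger (a z) * \<Phi> z + bc_star (b z) * bc_bar (\<Phi> z)) | \<Phi> D.
        \<Phi> \<in> bc_components_in (W012_fun \<Omega>) \<and> D \<in> bc_components_in (L2_fun \<Omega>) \<and>
        weak_bc_d \<Omega> \<Phi> D}"


section \<open>Liapunov curves\<close>

text \<open>The curve is given by a 1-periodic regular \<open>C\<^sup>1\<close> parametrization \<open>\<gamma>\<close> of the line, which is a
  Jordan curve on \<open>{0..1}\<close>. The tangent angle \<open>\<theta>\<close> is a function of the point of the curve; it is
  determined modulo \<open>2\<pi>\<close> only (it turns by \<open>\<plusminus>2\<pi>\<close> along the curve), and the Hoelder condition is
  therefore stated for angular distance.\<close>

definition liapunov_curve :: "complex set \<Rightarrow> bool" where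
  "liapunov_curve \<Gamma> \<longleftrightarrow>
     (\<exists>(\<gamma>::real \<Rightarrow> complex) \<gamma>' (\<theta>::complex \<Rightarrow> real) K \<alpha>.
        (\<forall>t. \<gamma> (t + 1) = \<gamma> t) \<and> simple_path \<gamma> \<and> path_image \<gamma> = \<Gamma> \<and>
        (\<forall>t. (\<gamma> has_vector_derivative \<gamma>' t) (at t)) \<and> continuous_on UNIV \<gamma>' \<and>
        (\<forall>t. \<gamma>' t \<noteq> 0 \<and> \<gamma>' t = of_real (cmod (\<gamma>' t)) * cis (\<theta> (\<gamma> t))) \<and>
        0 < \<alpha> \<and> \<alpha> \<le> 1 \<and>
        (\<forall>z\<in>\<Gamma>. \<forall>w\<in>\<Gamma>. \<exists>n::int.
           \<bar>\<theta> z - \<theta> w - 2 * pi * of_int n\<bar> \<le> K * cmod (z - w) powr \<alpha>))"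

end

theory Submission
  imports Defs
begin

text \<open>Writing \<open>R\<close> for the range of the adjoint operator, the Bergman space is the orthogonal
  complement of \<open>R\<close>: for a test function \<open>\<Phi>\<close> the product
  \<open>\<langle>W, \<partial>\<Phi> + a\<^sup>\<dagger>\<Phi> + b\<^sup>* C\<^sub>B \<Phi>\<rangle>\<close> is the scalar part of the weak Vekua equation of \<open>W\<close> tested
  with \<open>\<Phi>\<^sup>\<dagger>\<close>, and the scalar parts for all test functions already determine the
  bicomplex equation. Test functions are dense in \<open>W\<^sub>0\<^sup>1\<^sup>,\<^sup>2\<close>, and the weak derivative is unique by
  the fundamental lemma of the calculus of variations, so orthogonality extends to all of \<open>R\<close>.
  The decomposition is then the projection onto the closure of \<open>R\<close> in the complete space \<open>L\<^sub>2\<close>.\<close>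

subsection \<open>Square integrable functions\<close>

text \<open>Two mismatches shape the proof. The type \<open>bicomplex\<close> is only a ring,
  without norm or topology, and the weak equation pairs functions bilinearly while the inner product
  is Hermitian. For the first, \<open>bc_pair\<close> sends values into the Euclidean space of pairs
  of complex numbers, where the projection runs with a real inner product, the real part of
  \<open>bc_inner\<close>; imaginary parts are recovered because the range and its closure are
  stable under multiplication by \<open>\<i>\<close>. For the second, \<open>bc_dagger\<close> is an
  involution that exchanges the two Cauchy-Riemann operators and turns the bilinear pairing into the
  Hermitian one.

  Uniqueness of the weak derivative matters because an element of the range involves an arbitrary
  weak derivative \<open>D\<close> of \<open>\<Phi>\<close>, whereas the approximating test
  functions converge to the derivative built from particular weak partials. Functions remain
  representatives throughout: the projection is a measurable pointwise limit of a minimizing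
  sequence in the range, and that sequence also shows that the limit lies in the closure.\<close>

definition l2 :: "'a measure \<Rightarrow> ('a \<Rightarrow> 'b::euclidean_space) set" where
  "l2 M = {f \<in> borel_measurable M. integrable M (\<lambda>x. (norm (f x))\<^sup>2)}"

definition l2_norm :: "'a measure \<Rightarrow> ('a \<Rightarrow> 'b::euclidean_space) \<Rightarrow> real" where
  "l2_norm M f = sqrt (\<integral>x. (norm (f x))\<^sup>2 \<partial>M)"

lemma l2_measurable [measurable_dest]: "f \<in> l2 M \<Longrightarrow> f \<in> borel_measurable M"
  and l2_integrable: "f \<in> l2 M \<Longrightarrow> integrable M (\<lambda>x. (norm (f x))\<^sup>2)"
  by (auto simp: l2_def)

lemma l2_norm_nonneg [simp]: "0 \<le> l2_norm M f"
  by (simp add: l2_norm_def)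

lemma l2_norm_power2: "(l2_norm M f)\<^sup>2 = (\<integral>x. (norm (f x))\<^sup>2 \<partial>M)"
  by (simp add: l2_norm_def)

lemma integrable_dominated:
  fixes f :: "'a \<Rightarrow> 'b::{banach, second_countable_topology}" and g :: "'a \<Rightarrow> real"
  assumes "integrable M g" and "f \<in> borel_measurable M" and "\<And>x. norm (f x) \<le> g x"
  shows "integrable M f"
  using assms(1,2) by (rule Bochner_Integration.integrable_bound) (intro AE_I2 order_trans[OF assms(3)], simp)

lemma l2_bound:
  assumes "g \<in> l2 M" and "f \<in> borel_measurable M" and "AE x in M. norm (f x) \<le> C * norm (g x)"
  shows "f \<in> l2 M"
proof -
  note [measurable] = assms(2)
  have "integrable M (\<lambda>x. C\<^sup>2 * (norm (g x))\<^sup>2)"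
    using l2_integrable[OF assms(1)] by simp
  moreover have "AE x in M. norm ((norm (f x))\<^sup>2) \<le> norm (C\<^sup>2 * (norm (g x))\<^sup>2)"
    using assms(3)
  proof eventually_elim
    case (elim x)
    then have "(norm (f x))\<^sup>2 \<le> (C * norm (g x))\<^sup>2"
      by (intro power_mono) auto
    then show ?case
      by (simp add: power_mult_distrib)
  qed
  ultimately have "integrable M (\<lambda>x. (norm (f x))\<^sup>2)"
    by (intro Bochner_Integration.integrable_bound[where g="\<lambda>x. (norm (f x))\<^sup>2"
          and f="\<lambda>x. C\<^sup>2 * (norm (g x))\<^sup>2"]) measurable
  then show ?thesis
    using assms(2) by (simp add: l2_def)
qed

lemma l2_zero [simp]: "(\<lambda>x. 0) \<in> l2 M"
  by (simp add: l2_def)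

lemma l2_add:
  assumes f: "f \<in> l2 M" and g: "g \<in> l2 M"
  shows "(\<lambda>x. f x + g x) \<in> l2 M"
proof -
  note [measurable] = l2_measurable[OF f] l2_measurable[OF g]
  have int: "integrable M (\<lambda>x. 2 * (norm (f x))\<^sup>2 + 2 * (norm (g x))\<^sup>2)"
    using l2_integrable[OF f] l2_integrable[OF g] by simp
  have le: "(norm (f x + g x))\<^sup>2 \<le> 2 * (norm (f x))\<^sup>2 + 2 * (norm (g x))\<^sup>2" for x
  proof -
    have "(norm (f x + g x))\<^sup>2 \<le> (norm (f x) + norm (g x))\<^sup>2"
      by (intro power_mono norm_triangle_ineq) auto
    also have "\<dots> \<le> 2 * (norm (f x))\<^sup>2 + 2 * (norm (g x))\<^sup>2"
      using zero_le_power2[of "norm (f x) - norm (g x)"] by (simp add: power2_eq_square algebra_simps)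
    finally show ?thesis .
  qed
  have "integrable M (\<lambda>x. (norm (f x + g x))\<^sup>2)"
    by (rule integrable_dominated[OF int]) (use le in auto)
  then show ?thesis
    by (simp add: l2_def)
qed

lemma l2_minus: "f \<in> l2 M \<Longrightarrow> (\<lambda>x. - f x) \<in> l2 M"
  by (rule l2_bound[where C=1 and g=f]) auto

lemma l2_diff: "f \<in> l2 M \<Longrightarrow> g \<in> l2 M \<Longrightarrow> (\<lambda>x. f x - g x) \<in> l2 M"
  using l2_add[of f M "\<lambda>x. - g x"] l2_minus[of g M] by simp

lemma l2_inner_integrable:
  assumes f: "f \<in> l2 M" and g: "g \<in> l2 M"
  shows "integrable M (\<lambda>x. f x \<bullet> g x)"
proof -
  note [measurable] = l2_measurable[OF f] l2_measurable[OF g]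
  have int: "integrable M (\<lambda>x. (norm (f x))\<^sup>2 + (norm (g x))\<^sup>2)"
    using l2_integrable[OF f] l2_integrable[OF g] by simp
  have le: "\<bar>f x \<bullet> g x\<bar> \<le> (norm (f x))\<^sup>2 + (norm (g x))\<^sup>2" for x
  proof -
    have "0 \<le> (norm (f x) - norm (g x))\<^sup>2" "0 \<le> norm (f x) * norm (g x)"
      by auto
    then show ?thesis
      using Cauchy_Schwarz_ineq2[of "f x" "g x"] by (simp add: power2_eq_square algebra_simps)
  qed
  show ?thesis
    by (rule integrable_dominated[OF int]) (use le in auto)
qed

section \<open>Cauchy-Schwarz and triangle inequalities\<close>

text \<open>Serves twice: for the Cauchy-Schwarz inequality, and in the projection, where
  near-minimality of a distance produces such a quadratic. No sign of \<open>C\<close> is assumed;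
  if \<open>C\<close> is not positive, nonnegativity for all \<open>t\<close> forces
  \<open>B = 0\<close> and \<open>C = 0\<close>.\<close>

lemma nonneg_quadratic_discriminant:
  fixes A B C :: real
  assumes nonneg: "\<And>t. 0 \<le> A + 2 * t * B + t\<^sup>2 * C"
  shows "B\<^sup>2 \<le> A * C"
proof (cases "C > 0")
  case True
  \<comment> \<open>The minimizer of the quadratic is \<open>- B / C\<close>; the factor
    \<open>C\<close> clears the denominator.\<close>
  have "0 \<le> C * (A + 2 * (- B / C) * B + (- B / C)\<^sup>2 * C)"
    using True nonneg[of "- B / C"] by simp
  also have "\<dots> = A * C - B\<^sup>2"
    using True by (simp add: field_simps power2_eq_square)
  finally show ?thesis by simp
next
  case False
  have A: "0 \<le> A" using nonneg[of 0] by simp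
  have "B = 0"
  proof (rule ccontr)
    assume "B \<noteq> 0"
    have "t\<^sup>2 * C \<le> 0" for t using False by (simp add: mult_nonneg_nonpos)
    \<comment> \<open>This \<open>t\<close> gives the affine part the value -1, while the quadratic
      term is not positive.\<close>
    moreover have "A + 2 * (- (A + 1) / (2 * B)) * B = -1"
      using \<open>B \<noteq> 0\<close> by (simp add: field_simps)
    ultimately show False
      using nonneg[of "- (A + 1) / (2 * B)"] by (smt (verit))
  qed
  moreover have "C = 0"
  proof (rule ccontr)
    assume "C \<noteq> 0"
    then have C: "C < 0" using False by simp
    \<comment> \<open>Chosen so that \<open>t * (- C) = A - C\<close>, which exceeds
      \<open>A\<close>, and \<open>1 \<le> t\<close>; then \<open>t\<^sup>2 * (- C)\<close> exceeds
      \<open>A\<close> as well.\<close>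
    define t where "t = 1 + A / (- C)"
    have t: "1 \<le> t" "t * (- C) = A - C"
      using A C by (simp_all add: t_def field_simps divide_le_0_iff)
    have "t * (- C) \<le> t\<^sup>2 * (- C)"
      using t C by (intro mult_right_mono self_le_power) auto
    moreover have "0 \<le> A + t\<^sup>2 * C"
      using nonneg[of t] \<open>B = 0\<close> by simp
    ultimately show False
      using t C by linarith
  qed
  ultimately show ?thesis by simp
qed

lemma l2_expand:
  assumes f: "f \<in> l2 M" and g: "g \<in> l2 M"
  shows "(\<integral>x. (norm (f x + t *\<^sub>R g x))\<^sup>2 \<partial>M)
       = (\<integral>x. (norm (f x))\<^sup>2 \<partial>M) + 2 * t * (\<integral>x. f x \<bullet> g x \<partial>M) + t\<^sup>2 * (\<integral>x. (norm (g x))\<^sup>2 \<partial>M)"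
proof -
  have "(norm (f x + t *\<^sub>R g x))\<^sup>2 = (norm (f x))\<^sup>2 + 2 * t * (f x \<bullet> g x) + t\<^sup>2 * (norm (g x))\<^sup>2" for x
    unfolding power2_norm_eq_inner by (simp add: inner_commute[of "g x" "f x"] power2_eq_square algebra_simps)
  then show ?thesis
    using l2_integrable[OF f] l2_integrable[OF g] l2_inner_integrable[OF f g]
    by simp
qed

text \<open>The squared norm of \<open>f + t *\<^sub>R g\<close> is a nonnegative quadratic in
  \<open>t\<close>.\<close>

lemma l2_Cauchy_Schwarz:
  assumes f: "f \<in> l2 M" and g: "g \<in> l2 M"
  shows "\<bar>\<integral>x. f x \<bullet> g x \<partial>M\<bar> \<le> l2_norm M f * l2_norm M g"
proof -
  have "(\<integral>x. f x \<bullet> g x \<partial>M)\<^sup>2 \<le> (\<integral>x. (norm (f x))\<^sup>2 \<partial>M) * (\<integral>x. (norm (g x))\<^sup>2 \<partial>M)"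
    by (rule nonneg_quadratic_discriminant) (simp flip: l2_expand[OF f g])
  then have "\<bar>\<integral>x. f x \<bullet> g x \<partial>M\<bar>\<^sup>2 \<le> (l2_norm M f * l2_norm M g)\<^sup>2"
    by (simp add: power_mult_distrib l2_norm_power2)
  then show ?thesis
    by (rule power2_le_imp_le) simp
qed

lemma l2_norm_triangle:
  assumes f: "f \<in> l2 M" and g: "g \<in> l2 M"
  shows "l2_norm M (\<lambda>x. f x + g x) \<le> l2_norm M f + l2_norm M g"
proof (rule power2_le_imp_le)
  have "(l2_norm M (\<lambda>x. f x + g x))\<^sup>2 = (l2_norm M f)\<^sup>2 + 2 * (\<integral>x. f x \<bullet> g x \<partial>M) + (l2_norm M g)\<^sup>2"
    using l2_expand[OF f g, of 1] by (simp add: l2_norm_power2)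
  then show "(l2_norm M (\<lambda>x. f x + g x))\<^sup>2 \<le> (l2_norm M f + l2_norm M g)\<^sup>2"
    using l2_Cauchy_Schwarz[OF f g] by (simp add: power2_eq_square algebra_simps)
qed simp

lemma l2_norm_cmult:
  assumes "\<And>x. norm (f x) = c * norm (g x)" and "0 \<le> c"
  shows "l2_norm M f = c * l2_norm M g"
  using assms(2) by (simp add: l2_norm_def assms(1) power_mult_distrib real_sqrt_mult)

lemma l2_imp_integrable:
  assumes M: "finite_measure M" and f: "f \<in> l2 M"
  shows "integrable M f"
proof -
  interpret finite_measure M by (rule M)
  note [measurable] = l2_measurable[OF f]
  have int: "integrable M (\<lambda>x. 1 + (norm (f x))\<^sup>2)"
    using l2_integrable[OF f] by simp
  have le: "norm (f x) \<le> 1 + (norm (f x))\<^sup>2" for x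
    using zero_le_power2[of "norm (f x) - 1"] norm_ge_zero[of "f x"]
    by (simp add: power2_eq_square algebra_simps, linarith)
  show ?thesis
    by (rule integrable_dominated[OF int]) (use le in auto)
qed

text \<open>Cauchy-Schwarz against the constant function 1.\<close>

lemma l2_norm_L1:
  fixes f :: "'a \<Rightarrow> 'b::euclidean_space"
  assumes M: "finite_measure M" and f: "f \<in> l2 M"
  shows "(\<integral>x. norm (f x) \<partial>M) \<le> l2_norm M f * sqrt (measure M (space M))"
proof -
  interpret finite_measure M by (rule M)
  have 1: "(\<lambda>x. 1::real) \<in> l2 M" by (simp add: l2_def)
  have n: "(\<lambda>x. norm (f x)) \<in> l2 M"
    by (rule l2_bound[OF f, where C=1]) (use l2_measurable[OF f] in auto)
  show ?thesis
    using l2_Cauchy_Schwarz[OF n 1] by (simp add: l2_norm_def)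
qed

section \<open>Completeness of L2 over a finite measure\<close>

text \<open>On a finite measure the L2 bounds become L1 bounds, so the norms of the increments have
  a finite total integral; hence the telescoping series converges absolutely at almost every
  point.\<close>

lemma l2_Cauchy_AE_convergent:
  fixes G :: "nat \<Rightarrow> 'a \<Rightarrow> 'b::euclidean_space"
  assumes M: "finite_measure M" and G: "\<And>n. G n \<in> l2 M"
    and C: "\<And>n. l2_norm M (\<lambda>x. G (Suc n) x - G n x) \<le> C * (1/2) ^ n"
  shows "AE x in M. convergent (\<lambda>n. G n x)"
proof -
  interpret finite_measure M by (rule M)
  define d where "d n x = norm (G (Suc n) x - G n x)" for n x
  have dif: "(\<lambda>x. G (Suc n) x - G n x) \<in> l2 M" for n
    by (intro l2_diff G)
  have [measurable]: "G n \<in> borel_measurable M" for n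
    using G by (rule l2_measurable)
  have int: "integrable M (d n)" for n
    unfolding d_def by (intro integrable_norm l2_imp_integrable M dif)
  have [measurable]: "d n \<in> borel_measurable M" for n
    using int by simp
  define K where "K = C * sqrt (measure M (space M))"
  have K: "(\<integral>x. d n x \<partial>M) \<le> K * (1/2) ^ n" for n
    using l2_norm_L1[OF M dif, of n]
          mult_right_mono[OF C[of n], of "sqrt (measure M (space M))"]
    by (simp add: d_def K_def mult_ac)
  have "K \<ge> 0"
    using order_trans[OF integral_nonneg_AE[where M=M and f="d 0"] K[of 0]] by (simp add: d_def)
  have "(\<integral>\<^sup>+x. (\<Sum>n. ennreal (d n x)) \<partial>M) = (\<Sum>n. \<integral>\<^sup>+x. ennreal (d n x) \<partial>M)"
    by (rule nn_integral_suminf) measurable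
  also have "\<dots> = (\<Sum>n. ennreal (\<integral>x. d n x \<partial>M))"
    using int by (subst nn_integral_eq_integral) (auto simp: d_def)
  also have "\<dots> \<le> (\<Sum>n. ennreal (K * (1/2) ^ n))"
    by (intro suminf_le ennreal_leI K) auto
  also have "\<dots> = ennreal (\<Sum>n. K * (1/2) ^ n)"
    using \<open>K \<ge> 0\<close> by (intro suminf_ennreal2 summable_mult) (auto intro: summable_geometric)
  finally have "(\<integral>\<^sup>+x. (\<Sum>n. ennreal (d n x)) \<partial>M) \<noteq> \<infinity>"
    by (auto simp: top_unique)
  then have "AE x in M. (\<Sum>n. ennreal (d n x)) \<noteq> \<infinity>"
    by (intro nn_integral_PInf_AE) measurable
  then show ?thesis
  proof eventually_elim
    case (elim x)
    then have "summable (\<lambda>n. d n x)"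
      by (intro summable_suminf_not_top) (auto simp: d_def)
    then have "summable (\<lambda>n. G (Suc n) x - G n x)"
      unfolding d_def by (rule summable_norm_cancel)
    then have "convergent (\<lambda>n. \<Sum>i<n. G (Suc i) x - G i x)"
      by (simp add: summable_iff_convergent)
    then have "convergent (\<lambda>n. (G n x - G 0 x) + G 0 x)"
      unfolding sum_lessThan_telescope[where f="\<lambda>n. G n x"] by (intro convergent_add convergent_const)
    then show ?case by simp
  qed
qed

text \<open>Riesz-Fischer for sequences with a geometric Cauchy rate, which spares the choice of a
  subsequence. Fatou's lemma in \<open>m\<close> transfers the rate to the distance from the
  limit.\<close>

lemma l2_complete:
  fixes G :: "nat \<Rightarrow> 'a \<Rightarrow> 'b::euclidean_space"
  assumes M: "finite_measure M" and G: "\<And>n. G n \<in> l2 M" and "0 \<le> C"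
    and C: "\<And>n m. n \<le> m \<Longrightarrow> l2_norm M (\<lambda>x. G m x - G n x) \<le> C * (1/2) ^ n"
  obtains H where "H \<in> l2 M" and "\<And>n. l2_norm M (\<lambda>x. G n x - H x) \<le> C * (1/2) ^ n"
proof -
  interpret finite_measure M by (rule M)
  \<comment> \<open>Where the sequence diverges, \<open>lim\<close> has an unspecified value; this
    happens only on a null set, and \<open>H\<close> is measurable nevertheless.\<close>
  define H where "H x = lim (\<lambda>n. G n x)" for x
  have [measurable]: "G n \<in> borel_measurable M" for n
    using G by (rule l2_measurable)
  have [measurable]: "H \<in> borel_measurable M"
    unfolding H_def by measurable
  have "AE x in M. convergent (\<lambda>n. G n x)"
    by (rule l2_Cauchy_AE_convergent[OF M G, where C=C]) (use C in auto)
  then have lim: "AE x in M. (\<lambda>n. G n x) \<longlonglongrightarrow> H x"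
    by (simp add: H_def convergent_LIMSEQ_iff)
  have le: "(\<integral>\<^sup>+x. ennreal ((norm (G n x - H x))\<^sup>2) \<partial>M) \<le> ennreal ((C * (1/2) ^ n)\<^sup>2)" for n
  proof -
    \<comment> \<open>For almost every \<open>x\<close> the value \<open>H x\<close> is the limit of
      \<open>G m x\<close>, so the integrand is a limit inferior and Fatou's lemma applies.\<close>
    have "(\<integral>\<^sup>+x. ennreal ((norm (G n x - H x))\<^sup>2) \<partial>M)
        = (\<integral>\<^sup>+x. liminf (\<lambda>m. ennreal ((norm (G m x - G n x))\<^sup>2)) \<partial>M)"
    proof (rule nn_integral_cong_AE, use lim in eventually_elim)
      case (elim x)
      then have "(\<lambda>m. ennreal ((norm (G m x - G n x))\<^sup>2)) \<longlonglongrightarrow> ennreal ((norm (H x - G n x))\<^sup>2)"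
        by (intro tendsto_intros)
      from lim_imp_Liminf[OF _ this] show ?case
        by (simp add: norm_minus_commute)
    qed
    also have "\<dots> \<le> liminf (\<lambda>m. \<integral>\<^sup>+x. ennreal ((norm (G m x - G n x))\<^sup>2) \<partial>M)"
      by (rule nn_integral_liminf) measurable
    also have "\<dots> \<le> liminf (\<lambda>m. ennreal ((C * (1/2) ^ n)\<^sup>2))"
    proof (rule Liminf_mono)
      show "\<forall>\<^sub>F m in sequentially. (\<integral>\<^sup>+x. ennreal ((norm (G m x - G n x))\<^sup>2) \<partial>M) \<le> ennreal ((C * (1/2) ^ n)\<^sup>2)"
        using eventually_ge_at_top[of n]
      proof eventually_elim
        case (elim m)
        have "(\<integral>x. (norm (G m x - G n x))\<^sup>2 \<partial>M) \<le> (C * (1/2) ^ n)\<^sup>2"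
          unfolding l2_norm_power2[symmetric] using C[OF elim] by (rule power_mono) simp
        then show ?case
          using l2_integrable[OF l2_diff[OF G G]] by (simp add: nn_integral_eq_integral ennreal_leI)
      qed
    qed
    finally show ?thesis by (simp add: Liminf_const)
  qed
  have int: "integrable M (\<lambda>x. (norm (G n x - H x))\<^sup>2)" for n
    using le[of n] by (intro integrableI_bounded) (auto simp: less_top[symmetric] top_unique)
  then have dif: "(\<lambda>x. G n x - H x) \<in> l2 M" for n
    by (simp add: l2_def)
  have "H \<in> l2 M"
    using l2_diff[OF G[of 0] dif[of 0]] by simp
  moreover have "l2_norm M (\<lambda>x. G n x - H x) \<le> C * (1/2) ^ n" for n
  proof (rule power2_le_imp_le)
    show "(l2_norm M (\<lambda>x. G n x - H x))\<^sup>2 \<le> (C * (1/2) ^ n)\<^sup>2"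
      using le[of n] int[of n] unfolding l2_norm_power2 by (simp add: nn_integral_eq_integral)
  qed (use \<open>0 \<le> C\<close> in simp)
  ultimately show ?thesis
    by (rule that)
qed

section \<open>Orthogonal projection\<close>

lemma l2_inner_tendsto:
  assumes F: "F \<in> l2 M" and G: "\<And>n. G n \<in> l2 M" and H: "H \<in> l2 M"
    and lim: "(\<lambda>n. l2_norm M (\<lambda>x. G n x - H x)) \<longlonglongrightarrow> 0"
  shows "(\<lambda>n. \<integral>x. F x \<bullet> G n x \<partial>M) \<longlonglongrightarrow> (\<integral>x. F x \<bullet> H x \<partial>M)"
proof (rule LIM_zero_cancel, rule Lim_null_comparison[OF always_eventually])
  have "(\<integral>x. F x \<bullet> G n x \<partial>M) - (\<integral>x. F x \<bullet> H x \<partial>M) = (\<integral>x. F x \<bullet> (G n x - H x) \<partial>M)" for n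
    by (simp add: inner_diff_right l2_inner_integrable F G H)
  then show "\<forall>n. norm ((\<integral>x. F x \<bullet> G n x \<partial>M) - (\<integral>x. F x \<bullet> H x \<partial>M))
      \<le> l2_norm M F * l2_norm M (\<lambda>x. G n x - H x)"
    using l2_Cauchy_Schwarz[OF F l2_diff[OF G H]] by simp
  show "(\<lambda>n. l2_norm M F * l2_norm M (\<lambda>x. G n x - H x)) \<longlonglongrightarrow> 0"
    using tendsto_mult_right_zero[OF lim] .
qed

text \<open>A minimizing sequence is Cauchy by the parallelogram law. As \<open>R\<close> is not
  assumed closed, \<open>H\<close> need not lie in it; the sequence \<open>G\<close> records that
  \<open>H\<close> lies in the closure. Only real scalars are used here.\<close>

lemma l2_projection:
  fixes F :: "'a \<Rightarrow> 'b::euclidean_space"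
  assumes M: "finite_measure M" and R: "R \<subseteq> l2 M" "(\<lambda>x. 0) \<in> R"
    and R_add: "\<And>G H. G \<in> R \<Longrightarrow> H \<in> R \<Longrightarrow> (\<lambda>x. G x + H x) \<in> R"
    and R_scale: "\<And>G c. G \<in> R \<Longrightarrow> (\<lambda>x. c *\<^sub>R G x) \<in> R"
    and F: "F \<in> l2 M"
  obtains H G where "H \<in> l2 M" and "\<And>n::nat. G n \<in> R"
    and "(\<lambda>n. l2_norm M (\<lambda>x. G n x - H x)) \<longlonglongrightarrow> 0"
    and "\<And>K. K \<in> R \<Longrightarrow> (\<integral>x. (F x - H x) \<bullet> K x \<partial>M) = 0"
proof -
  define q where "q f = (\<integral>x. (norm (f x))\<^sup>2 \<partial>M)" for f :: "'a \<Rightarrow> 'b"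
  define D where "D = (\<lambda>G. q (\<lambda>x. F x - G x)) ` R"
  define d where "d = Inf D"
  have RL: "G \<in> R \<Longrightarrow> G \<in> l2 M" for G
    using R by auto
  have "D \<noteq> {}" using R by (auto simp: D_def)
  have "bdd_below D"
    by (rule bdd_belowI[of _ 0]) (auto simp: D_def q_def)
  then have d_le: "d \<le> q (\<lambda>x. F x - G x)" if "G \<in> R" for G
    unfolding d_def using that by (intro cInf_lower) (auto simp: D_def)
  \<comment> \<open>Squared distances approach the infimum at rate \<open>(1/4) ^ n\<close>, which
    becomes the rate \<open>(1/2) ^ n\<close> of norms that the completeness lemma asks for.\<close>
  have "\<exists>G\<in>R. q (\<lambda>x. F x - G x) < d + (1/4) ^ n" for n
  proof -
    have "\<exists>y\<in>D. y < d + (1/4) ^ n"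
      using \<open>D \<noteq> {}\<close> \<open>bdd_below D\<close> by (subst cInf_less_iff[symmetric]) (auto simp: d_def)
    then show ?thesis by (auto simp: D_def)
  qed
  then obtain G where GR: "\<And>n. G n \<in> R" and Gd: "\<And>n. q (\<lambda>x. F x - G n x) < d + (1/4) ^ n"
    by metis
  have G: "G n \<in> l2 M" for n using GR RL by auto
  have cauchy: "l2_norm M (\<lambda>x. G m x - G n x) \<le> 2 * (1/2) ^ n" if "n \<le> m" for n m
  proof (rule power2_le_imp_le)
    \<comment> \<open>The midpoint of two members of \<open>R\<close> is a competitor, so the sum
      term of the parallelogram law is at least \<open>4 * d\<close>; at most
      \<open>2 * (1/4) ^ n + 2 * (1/4) ^ m\<close> is left for the difference term.\<close>
    have mid: "(\<lambda>x. (1/2) *\<^sub>R (G n x + G m x)) \<in> R"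
      by (intro R_scale R_add GR)
    define u where "u k x = F x - G k x" for k x
    have u: "u k \<in> l2 M" for k
      using l2_diff[OF F G] by (simp add: u_def[abs_def])
    have "q (\<lambda>x. u n x + u m x) + q (\<lambda>x. u n x - u m x) = 2 * q (u n) + 2 * q (u m)"
      using l2_expand[OF u u, of n 1 m] l2_expand[OF u u, of n "-1" m] by (simp add: q_def)
    moreover have "q (\<lambda>x. u n x - u m x) = (l2_norm M (\<lambda>x. G m x - G n x))\<^sup>2"
      by (simp add: u_def q_def l2_norm_power2)
    moreover have "q (\<lambda>x. u n x + u m x) \<ge> 4 * d"
    proof -
      have "u n x + u m x = 2 *\<^sub>R (F x - (1/2) *\<^sub>R (G n x + G m x))" for x
        by (simp add: u_def algebra_simps scaleR_2)
      then have "q (\<lambda>x. u n x + u m x) = 4 * q (\<lambda>x. F x - (1/2) *\<^sub>R (G n x + G m x))"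
        by (simp add: q_def power_mult_distrib)
      then show ?thesis using d_le[OF mid] by simp
    qed
    moreover have "q (u n) < d + (1/4) ^ n" "q (u m) < d + (1/4) ^ m"
      using Gd by (simp_all add: u_def[abs_def])
    moreover have "(1/4::real) ^ m \<le> (1/4) ^ n"
      using that by (intro power_decreasing) auto
    ultimately have "(l2_norm M (\<lambda>x. G m x - G n x))\<^sup>2 \<le> 4 * (1/4) ^ n"
      by linarith
    also have "\<dots> = (2 * (1/2) ^ n)\<^sup>2"
      by (simp add: power_mult_distrib power2_eq_square flip: power_mult_distrib)
    finally show "(l2_norm M (\<lambda>x. G m x - G n x))\<^sup>2 \<le> (2 * (1/2) ^ n)\<^sup>2" .
  qed simp
  obtain H where H: "H \<in> l2 M" and GH: "\<And>n. l2_norm M (\<lambda>x. G n x - H x) \<le> 2 * (1/2) ^ n"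
    by (rule l2_complete[OF M G _ cauchy]) auto
  have lim: "(\<lambda>n. l2_norm M (\<lambda>x. G n x - H x)) \<longlonglongrightarrow> 0"
  proof (rule Lim_null_comparison[OF always_eventually])
    show "\<forall>n. norm (l2_norm M (\<lambda>x. G n x - H x)) \<le> 2 * (1/2) ^ n"
      using GH by simp
    show "(\<lambda>n. 2 * (1/2) ^ n :: real) \<longlonglongrightarrow> 0"
      by (intro tendsto_mult_right_zero LIMSEQ_power_zero) simp
  qed
  have "(\<integral>x. (F x - H x) \<bullet> K x \<partial>M) = 0" if K: "K \<in> R" for K
  proof -
    have KL: "K \<in> l2 M" using K RL by auto
    define B where "B n = (\<integral>x. (F x - G n x) \<bullet> K x \<partial>M)" for n
    \<comment> \<open>A move from \<open>G n\<close> along \<open>K\<close> cannot bring the squared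
      distance below \<open>d\<close>, hence gains at most \<open>(1/4) ^ n\<close>; the
      discriminant of this quadratic in \<open>t\<close> bounds \<open>B n\<close>.\<close>
    have B_le: "(B n)\<^sup>2 \<le> (1/4) ^ n * q K" for n
    proof (rule nonneg_quadratic_discriminant)
      fix t :: real
      have "(\<lambda>x. G n x + (- t) *\<^sub>R K x) \<in> R"
        by (intro R_add R_scale GR K)
      from d_le[OF this] have "d \<le> q (\<lambda>x. (F x - G n x) + t *\<^sub>R K x)"
        by (simp add: algebra_simps)
      also have "\<dots> = q (\<lambda>x. F x - G n x) + 2 * t * B n + t\<^sup>2 * q K"
        unfolding q_def B_def by (rule l2_expand[OF l2_diff[OF F G] KL])
      finally show "0 \<le> (1/4) ^ n + 2 * t * B n + t\<^sup>2 * q K"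
        using Gd[of n] by simp
    qed
    have "(\<lambda>n. \<integral>x. K x \<bullet> G n x \<partial>M) \<longlonglongrightarrow> (\<integral>x. K x \<bullet> H x \<partial>M)"
      by (rule l2_inner_tendsto[OF KL G H lim])
    then have "(\<lambda>n. (\<integral>x. K x \<bullet> F x \<partial>M) - (\<integral>x. K x \<bullet> G n x \<partial>M))
        \<longlonglongrightarrow> (\<integral>x. K x \<bullet> F x \<partial>M) - (\<integral>x. K x \<bullet> H x \<partial>M)"
      by (intro tendsto_intros)
    then have "B \<longlonglongrightarrow> (\<integral>x. (F x - H x) \<bullet> K x \<partial>M)"
      by (simp add: B_def[abs_def] inner_commute[of _ "K _"] inner_diff_right l2_inner_integrable KL F G H)
    then have "(\<lambda>n. (B n)\<^sup>2) \<longlonglongrightarrow> (\<integral>x. (F x - H x) \<bullet> K x \<partial>M)\<^sup>2"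
      by (intro tendsto_intros)
    moreover have "(\<lambda>n. (B n)\<^sup>2) \<longlonglongrightarrow> 0"
    proof (rule Lim_null_comparison[OF always_eventually])
      show "\<forall>n. norm ((B n)\<^sup>2) \<le> (1/4) ^ n * q K" using B_le by simp
      show "(\<lambda>n. (1/4) ^ n * q K) \<longlonglongrightarrow> 0"
        by (intro tendsto_mult_left_zero LIMSEQ_power_zero) simp
    qed
    ultimately show ?thesis
      using LIMSEQ_unique by fastforce
  qed
  with H GR lim show ?thesis
    by (rule that)
qed

subsection \<open>Test functions\<close>

lemma C_k_continuous: "C_k k f \<Longrightarrow> continuous_on UNIV f"
  by (cases k) (auto intro: differentiable_imp_continuous_on)

lemma C_k_Suc_imp: "C_k (Suc k) f \<Longrightarrow> C_k k f"
proof (induction k arbitrary: f)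
  case 0
  then show ?case by (auto intro: differentiable_imp_continuous_on)
next
  case (Suc k)
  then show ?case by (metis C_k.simps(2))
qed

lemma has_derivative_pderiv_dir:
  assumes "f differentiable_on UNIV"
  shows "(f has_derivative (\<lambda>v. pderiv_dir v f z)) (at z)"
  using assms frechet_derivative_works[of f "at z"]
  by (simp add: differentiable_on_def pderiv_dir_def)

lemma pderiv_dir_eq:
  "(f has_derivative f') (at z) \<Longrightarrow> pderiv_dir v f z = f' v"
  unfolding pderiv_dir_def using frechet_derivative_at by metis

text \<open>\<open>C_k\<close> refers to the derivative selected by
  \<open>frechet_derivative\<close>; by uniqueness any exhibited derivative may take its
  place.\<close>

lemma C_k_SucI:
  assumes "\<And>z. (f has_derivative (\<lambda>v. f' v z)) (at z)" and "C_k k (f' 1)" and "C_k k (f' \<i>)"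
  shows "C_k (Suc k) f"
proof -
  have "pderiv_dir v f = f' v" for v
    using pderiv_dir_eq[OF assms(1)] by blast
  with assms show ?thesis
    by (auto simp: differentiable_on_def differentiable_def)
qed

lemma C_k_SucD:
  assumes "C_k (Suc k) f"
  shows "(f has_derivative (\<lambda>v. pderiv_dir v f z)) (at z)"
    and "C_k k (pderiv_dir 1 f)" and "C_k k (pderiv_dir \<i> f)"
  using assms by (auto intro: has_derivative_pderiv_dir)

declare C_k.simps(2) [simp del]

lemma C_k_const: "C_k k (\<lambda>z. c)"
proof (induction k arbitrary: c)
  case (Suc k)
  show ?case
    by (rule C_k_SucI[where f'="\<lambda>v z. 0"]) (intro has_derivative_const Suc.IH)+
qed simp

lemma C_k_add: "C_k k f \<Longrightarrow> C_k k g \<Longrightarrow> C_k k (\<lambda>z. f z + g z)"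
proof (induction k arbitrary: f g)
  case (Suc k)
  show ?case
    by (rule C_k_SucI[where f'="\<lambda>v z. pderiv_dir v f z + pderiv_dir v g z"])
       (intro has_derivative_add Suc.IH C_k_SucD[OF Suc.prems(1)] C_k_SucD[OF Suc.prems(2)])+
qed (simp add: continuous_on_add)

lemma C_k_mult: "C_k k f \<Longrightarrow> C_k k g \<Longrightarrow> C_k k (\<lambda>z. f z * g z)"
proof (induction k arbitrary: f g)
  case (Suc k)
  \<comment> \<open>The product rule keeps undifferentiated factors, so the induction needs
    \<open>f\<close> and \<open>g\<close> themselves in class \<open>k\<close> too.\<close>
  note f = C_k_SucD[OF Suc.prems(1)] C_k_Suc_imp[OF Suc.prems(1)]
  note g = C_k_SucD[OF Suc.prems(2)] C_k_Suc_imp[OF Suc.prems(2)]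
  show ?case
    by (rule C_k_SucI[where f'="\<lambda>v z. f z * pderiv_dir v g z + pderiv_dir v f z * g z"])
       (intro has_derivative_mult f g C_k_add Suc.IH)+
qed (simp add: continuous_on_mult)

lemma C_k_cnj: "C_k k f \<Longrightarrow> C_k k (\<lambda>z. cnj (f z))"
proof (induction k arbitrary: f)
  case (Suc k)
  show ?case
    by (rule C_k_SucI[where f'="\<lambda>v z. cnj (pderiv_dir v f z)"])
       (intro has_derivative_cnj C_k_SucD[OF Suc.prems] Suc.IH)+
qed (simp add: continuous_on_cnj)

section \<open>Algebra of test functions and their derivatives\<close>

lemma test_fun_iff:
  "\<phi> \<in> test_fun \<Omega> \<longleftrightarrow> (\<forall>k. C_k k \<phi>) \<and> (\<exists>K. compact K \<and> K \<subseteq> \<Omega> \<and> (\<forall>z. z \<notin> K \<longrightarrow> \<phi> z = 0))"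
  by (simp add: test_fun_def)

lemma test_fun_has_derivative:
  "\<phi> \<in> test_fun \<Omega> \<Longrightarrow> (\<phi> has_derivative (\<lambda>v. pderiv_dir v \<phi> z)) (at z)"
  by (rule C_k_SucD[of 0]) (simp add: test_fun_iff)

lemma test_fun_zero [simp]: "(\<lambda>z. 0) \<in> test_fun \<Omega>"
  by (auto simp: test_fun_iff C_k_const intro: exI[of _ "{}"])

lemma test_fun_add:
  assumes "\<phi> \<in> test_fun \<Omega>" "\<psi> \<in> test_fun \<Omega>"
  shows "(\<lambda>z. \<phi> z + \<psi> z) \<in> test_fun \<Omega>"
proof -
  obtain K L where "compact K" "K \<subseteq> \<Omega>" "\<And>z. z \<notin> K \<Longrightarrow> \<phi> z = 0"
      "compact L" "L \<subseteq> \<Omega>" "\<And>z. z \<notin> L \<Longrightarrow> \<psi> z = 0"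
    using assms unfolding test_fun_iff by metis
  then show ?thesis
    using assms by (auto simp: test_fun_iff intro!: C_k_add exI[of _ "K \<union> L"])
qed

lemma test_fun_mult_left:
  assumes "\<phi> \<in> test_fun \<Omega>" "\<And>k. C_k k f"
  shows "(\<lambda>z. f z * \<phi> z) \<in> test_fun \<Omega>"
proof -
  obtain K where "compact K" "K \<subseteq> \<Omega>" "\<And>z. z \<notin> K \<Longrightarrow> \<phi> z = 0"
    using assms unfolding test_fun_iff by metis
  then show ?thesis
    using assms by (auto simp: test_fun_iff intro!: C_k_mult exI[of _ K])
qed

lemma test_fun_cmult: "\<phi> \<in> test_fun \<Omega> \<Longrightarrow> (\<lambda>z. c * \<phi> z) \<in> test_fun \<Omega>"
  by (rule test_fun_mult_left[OF _ C_k_const])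

lemma test_fun_uminus: "\<phi> \<in> test_fun \<Omega> \<Longrightarrow> (\<lambda>z. - \<phi> z) \<in> test_fun \<Omega>"
  using test_fun_cmult[of \<phi> \<Omega> "-1"] by simp

lemma test_fun_C_k: "\<phi> \<in> test_fun \<Omega> \<Longrightarrow> C_k k \<phi>"
  by (simp add: test_fun_iff)

lemma test_fun_mult: "\<phi> \<in> test_fun \<Omega> \<Longrightarrow> \<psi> \<in> test_fun \<Omega> \<Longrightarrow> (\<lambda>z. \<phi> z * \<psi> z) \<in> test_fun \<Omega>"
  by (rule test_fun_mult_left[OF _ test_fun_C_k])

lemma test_fun_cnj: "\<phi> \<in> test_fun \<Omega> \<Longrightarrow> (\<lambda>z. cnj (\<phi> z)) \<in> test_fun \<Omega>"
  by (auto simp: test_fun_iff intro: C_k_cnj)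

lemma pderiv_dir_add:
  "\<phi> \<in> test_fun \<Omega> \<Longrightarrow> \<psi> \<in> test_fun \<Omega> \<Longrightarrow>
    pderiv_dir v (\<lambda>z. \<phi> z + \<psi> z) z = pderiv_dir v \<phi> z + pderiv_dir v \<psi> z"
  by (intro pderiv_dir_eq has_derivative_add test_fun_has_derivative)

lemma pderiv_dir_mult:
  "\<phi> \<in> test_fun \<Omega> \<Longrightarrow> \<psi> \<in> test_fun \<Omega> \<Longrightarrow>
    pderiv_dir v (\<lambda>z. \<phi> z * \<psi> z) z = \<phi> z * pderiv_dir v \<psi> z + pderiv_dir v \<phi> z * \<psi> z"
  by (intro pderiv_dir_eq has_derivative_mult test_fun_has_derivative)

lemma pderiv_dir_cmult:
  "\<phi> \<in> test_fun \<Omega> \<Longrightarrow> pderiv_dir v (\<lambda>z. c * \<phi> z) z = c * pderiv_dir v \<phi> z"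
  by (intro pderiv_dir_eq has_derivative_mult_right test_fun_has_derivative)

lemma pderiv_dir_uminus:
  "\<phi> \<in> test_fun \<Omega> \<Longrightarrow> pderiv_dir v (\<lambda>z. - \<phi> z) z = - pderiv_dir v \<phi> z"
  by (intro pderiv_dir_eq has_derivative_minus test_fun_has_derivative)

lemma pderiv_dir_cnj:
  "\<phi> \<in> test_fun \<Omega> \<Longrightarrow> pderiv_dir v (\<lambda>z. cnj (\<phi> z)) z = cnj (pderiv_dir v \<phi> z)"
  by (intro pderiv_dir_eq has_derivative_cnj test_fun_has_derivative)

text \<open>Smoothness is defined through the directions 1 and \<open>\<i>\<close> only; linearity
  of the derivative carries it over to any direction \<open>v\<close>.\<close>

lemma pderiv_dir_linear:
  assumes \<phi>: "\<phi> \<in> test_fun \<Omega>"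
  shows "pderiv_dir v \<phi> z = of_real (Re v) * pderiv_dir 1 \<phi> z + of_real (Im v) * pderiv_dir \<i> \<phi> z"
proof -
  interpret linear "\<lambda>v. pderiv_dir v \<phi> z"
    by (rule has_derivative_linear[OF test_fun_has_derivative[OF \<phi>]])
  have "v = Re v *\<^sub>R 1 + Im v *\<^sub>R \<i>"
    by (simp add: complex_eq_iff)
  then have "pderiv_dir v \<phi> z = pderiv_dir (Re v *\<^sub>R 1 + Im v *\<^sub>R \<i>) \<phi> z"
    by simp
  then show ?thesis
    unfolding add scale by (simp add: scaleR_conv_of_real)
qed

lemma test_fun_pderiv_dir:
  assumes \<phi>: "\<phi> \<in> test_fun \<Omega>"
  shows "pderiv_dir v \<phi> \<in> test_fun \<Omega>"
proof -
  obtain K where K: "compact K" "K \<subseteq> \<Omega>" "\<And>z. z \<notin> K \<Longrightarrow> \<phi> z = 0"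
    using \<phi> unfolding test_fun_iff by metis
  have "C_k k (pderiv_dir 1 \<phi>)" "C_k k (pderiv_dir \<i> \<phi>)" for k
    using C_k_SucD[OF test_fun_C_k[OF \<phi>]] by auto
  then have "C_k k (\<lambda>z. of_real (Re v) * pderiv_dir 1 \<phi> z + of_real (Im v) * pderiv_dir \<i> \<phi> z)" for k
    by (intro C_k_add C_k_mult C_k_const)
  then have "C_k k (pderiv_dir v \<phi>)" for k
    by (simp flip: pderiv_dir_linear[OF \<phi>])
  moreover have "pderiv_dir v \<phi> z = 0" if "z \<notin> K" for z
  proof -
    \<comment> \<open>The complement of the compact set \<open>K\<close> is open, so
      \<open>\<phi>\<close> vanishes in a whole neighbourhood of \<open>z\<close>.\<close>
    have "(\<phi> has_derivative (\<lambda>v. 0)) (at z)"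
    proof (rule has_derivative_transform_within_open[of "\<lambda>z. 0"])
      show "open (- K)" using K compact_imp_closed by blast
    qed (use K that in auto)
    then show ?thesis by (rule pderiv_dir_eq)
  qed
  ultimately show ?thesis
    using K by (auto simp: test_fun_iff)
qed

section \<open>Bounds, integrals and integration by parts\<close>

lemma test_fun_bounded:
  assumes \<phi>: "\<phi> \<in> test_fun \<Omega>"
  obtains B where "0 < B" "\<And>z. cmod (\<phi> z) \<le> B"
proof -
  obtain K where K: "compact K" "\<And>z. z \<notin> K \<Longrightarrow> \<phi> z = 0"
    using \<phi> unfolding test_fun_iff by metis
  have "continuous_on K \<phi>"
    using C_k_continuous[OF test_fun_C_k[OF \<phi>, of 0]] continuous_on_subset by blast
  then have "bounded (\<phi> ` K)"
    using K compact_continuous_image compact_imp_bounded by blast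
  then obtain B where "0 < B" "\<And>z. z \<in> K \<Longrightarrow> cmod (\<phi> z) \<le> B"
    unfolding bounded_pos by auto
  then have "cmod (\<phi> z) \<le> B" for z
    using K by (cases "z \<in> K") auto
  with \<open>0 < B\<close> show ?thesis by (rule that)
qed

lemma test_fun_borel: "\<phi> \<in> test_fun \<Omega> \<Longrightarrow> \<phi> \<in> borel_measurable borel"
  using C_k_continuous[OF test_fun_C_k[of _ _ 0]] borel_measurable_continuous_onI by blast

text \<open>Mean value inequality on the plane. The sum \<open>B1 + B2\<close> bounds the operator
  norm of the derivative because neither \<open>Re v\<close> nor \<open>Im v\<close> exceeds
  \<open>cmod v\<close> in absolute value.\<close>

lemma test_fun_lipschitz:
  assumes \<phi>: "\<phi> \<in> test_fun \<Omega>"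
  obtains B where "0 < B" "\<And>z w. cmod (\<phi> z - \<phi> w) \<le> B * cmod (z - w)"
proof -
  obtain B1 where B1: "0 < B1" "\<And>z. cmod (pderiv_dir 1 \<phi> z) \<le> B1"
    using test_fun_bounded[OF test_fun_pderiv_dir[OF \<phi>]] by blast
  obtain B2 where B2: "0 < B2" "\<And>z. cmod (pderiv_dir \<i> \<phi> z) \<le> B2"
    using test_fun_bounded[OF test_fun_pderiv_dir[OF \<phi>]] by blast
  have "cmod (\<phi> z - \<phi> w) \<le> (B1 + B2) * cmod (z - w)" for z w
  proof (rule differentiable_bound[OF convex_UNIV])
    show "(\<phi> has_derivative (\<lambda>v. pderiv_dir v \<phi> x)) (at x within UNIV)" for x
      by (simp add: test_fun_has_derivative[OF \<phi>])
    show "onorm (\<lambda>v. pderiv_dir v \<phi> x) \<le> B1 + B2" for x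
    proof (rule onorm_bound)
      fix v
      have "cmod (pderiv_dir v \<phi> x) \<le> \<bar>Re v\<bar> * cmod (pderiv_dir 1 \<phi> x) + \<bar>Im v\<bar> * cmod (pderiv_dir \<i> \<phi> x)"
        unfolding pderiv_dir_linear[OF \<phi>, of v] by (rule order_trans[OF norm_triangle_ineq]) (simp add: norm_mult)
      also have "\<dots> \<le> cmod v * B1 + cmod v * B2"
        by (intro add_mono mult_mono B1 B2 abs_Re_le_cmod abs_Im_le_cmod) auto
      finally show "cmod (pderiv_dir v \<phi> x) \<le> (B1 + B2) * cmod v"
        by (simp add: algebra_simps)
    qed (use B1 B2 in simp)
  qed auto
  with B1(1) B2(1) show ?thesis
    by (intro that[of "B1 + B2"]) auto
qed

lemma test_fun_integrable_lborel:
  assumes \<phi>: "\<phi> \<in> test_fun \<Omega>"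
  shows "integrable lborel \<phi>"
proof -
  obtain K where K: "compact K" "\<And>z. z \<notin> K \<Longrightarrow> \<phi> z = 0"
    using \<phi> unfolding test_fun_iff by metis
  have "continuous_on K \<phi>"
    using C_k_continuous[OF test_fun_C_k[OF \<phi>, of 0]] continuous_on_subset by blast
  then have "integrable lborel (\<lambda>z. indicator K z *\<^sub>R \<phi> z)"
    using K by (intro borel_integrable_compact)
  also have "(\<lambda>z. indicator K z *\<^sub>R \<phi> z) = \<phi>"
    using K by (auto simp: indicator_def)
  finally show ?thesis .
qed

lemma integral_lborel_translation:
  fixes f :: "'a::euclidean_space \<Rightarrow> 'b::{banach, second_countable_topology}"
  assumes f: "integrable lborel f"
  shows "integrable lborel (\<lambda>x. f (c + x))" and "(\<integral>x. f (c + x) \<partial>lborel) = (\<integral>x. f x \<partial>lborel)"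
proof -
  have "integrable (distr lborel borel ((+) c)) f"
    using f by (simp add: lborel_distr_plus)
  then show "integrable lborel (\<lambda>x. f (c + x))"
    by (subst (asm) integrable_distr_eq) (use f in auto)
  have "(\<integral>x. f (c + x) \<partial>lborel) = (\<integral>x. f x \<partial>distr lborel borel ((+) c))"
    by (rule integral_distr[symmetric]) (use f in auto)
  then show "(\<integral>x. f (c + x) \<partial>lborel) = (\<integral>x. f x \<partial>lborel)"
    by (simp add: lborel_distr_plus)
qed

lemma difference_quotient_tendsto:
  fixes f :: "'a::real_normed_vector \<Rightarrow> 'b::real_normed_vector"
  assumes "(f has_derivative f') (at z)" and "h \<longlonglongrightarrow> 0" and "\<And>n. h n \<noteq> (0::real)"
  shows "(\<lambda>n. (1 / h n) *\<^sub>R (f (h n *\<^sub>R v + z) - f z)) \<longlonglongrightarrow> f' v"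
proof -
  interpret linear f' by (rule has_derivative_linear[OF assms(1)])
  \<comment> \<open>Restriction to the line through \<open>z\<close> in direction \<open>v\<close>
    leaves a derivative in one real variable, evaluated along \<open>h\<close>.\<close>
  have "((\<lambda>t. t *\<^sub>R v + z) has_derivative (\<lambda>t. t *\<^sub>R v)) (at 0)"
    by (auto intro!: derivative_eq_intros)
  then have "((\<lambda>t. f (t *\<^sub>R v + z)) has_derivative (\<lambda>t. f' (t *\<^sub>R v))) (at 0)"
    by (rule has_derivative_compose) (use assms(1) in simp)
  then have lim: "((\<lambda>t. norm (f (t *\<^sub>R v + z) - f z - f' (t *\<^sub>R v)) / norm t) \<longlongrightarrow> 0) (at 0)"
    by (simp add: has_derivative_at)
  have "filterlim h (at 0) sequentially"
    using assms by (auto simp: filterlim_at)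
  from filterlim_compose[OF lim this]
  have "(\<lambda>n. norm (f (h n *\<^sub>R v + z) - f z - f' (h n *\<^sub>R v)) / norm (h n)) \<longlonglongrightarrow> 0" .
  also have "(\<lambda>n. norm (f (h n *\<^sub>R v + z) - f z - f' (h n *\<^sub>R v)) / norm (h n))
      = (\<lambda>n. norm ((1 / h n) *\<^sub>R (f (h n *\<^sub>R v + z) - f z) - f' v))"
  proof
    fix n
    have "(1 / h n) *\<^sub>R (f (h n *\<^sub>R v + z) - f z) - f' v
        = (1 / h n) *\<^sub>R (f (h n *\<^sub>R v + z) - f z - f' (h n *\<^sub>R v))"
      using assms(3)[of n] by (simp add: scale scaleR_diff_right)
    then show "norm (f (h n *\<^sub>R v + z) - f z - f' (h n *\<^sub>R v)) / norm (h n)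
        = norm ((1 / h n) *\<^sub>R (f (h n *\<^sub>R v + z) - f z) - f' v)"
      by (simp add: divide_inverse)
  qed
  finally show ?thesis
    by (rule LIM_zero_cancel[OF tendsto_norm_zero_cancel])
qed

text \<open>The difference quotients have integral 0 by translation invariance and are dominated
  thanks to the Lipschitz bound.\<close>
lemma integral_pderiv_dir_eq_0:
  assumes \<phi>: "\<phi> \<in> test_fun \<Omega>"
  shows "(\<integral>z. pderiv_dir v \<phi> z \<partial>lborel) = 0"
proof -
  obtain B where B: "0 < B" "\<And>z w. cmod (\<phi> z - \<phi> w) \<le> B * cmod (z - w)"
    by (rule test_fun_lipschitz[OF \<phi>]) blast
  obtain K where K: "compact K" "\<And>z. z \<notin> K \<Longrightarrow> \<phi> z = 0"
    using \<phi> unfolding test_fun_iff by metis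
  obtain R where R: "\<And>z. z \<in> K \<Longrightarrow> cmod z \<le> R"
    using compact_imp_bounded[OF K(1)] unfolding bounded_iff by auto
  define h where "h n = 1 / real (Suc n)" for n
  have h: "0 < h n" "h n \<le> 1" for n
    by (auto simp: h_def)
  have h0: "h \<longlonglongrightarrow> 0"
    unfolding h_def by (rule LIMSEQ_Suc[OF lim_1_over_n])
  define s where "s n z = (1 / h n) *\<^sub>R (\<phi> (h n *\<^sub>R v + z) - \<phi> z)" for n z
  \<comment> \<open>Since \<open>h n \<le> 1\<close>, outside the ball of radius
    \<open>R + cmod v\<close> neither \<open>z\<close> nor the shifted point lies in
    \<open>K\<close>, and every quotient vanishes there.\<close>
  define S where "S = cball (0::complex) (R + cmod v)"
  have [measurable]: "\<phi> \<in> borel_measurable borel" "pderiv_dir v \<phi> \<in> borel_measurable borel"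
    using \<phi> test_fun_pderiv_dir[OF \<phi>] by (auto intro: test_fun_borel)
  have int\<phi>: "integrable lborel \<phi>"
    by (rule test_fun_integrable_lborel[OF \<phi>])
  have "(\<lambda>n. \<integral>z. s n z \<partial>lborel) \<longlonglongrightarrow> (\<integral>z. pderiv_dir v \<phi> z \<partial>lborel)"
  proof (rule integral_dominated_convergence)
    show "integrable lborel (\<lambda>z. (B * cmod v) * indicat_real S z)"
      by (intro integrable_mult_right integrable_real_indicator)
         (use emeasure_bounded_finite[of S] in \<open>auto simp: S_def\<close>)
    show "AE z in lborel. (\<lambda>n. s n z) \<longlonglongrightarrow> pderiv_dir v \<phi> z"
      unfolding s_def
      by (intro AE_I2 difference_quotient_tendsto[OF test_fun_has_derivative[OF \<phi>] h0]) (use h(1) in \<open>metis less_irrefl\<close>)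
    show "AE z in lborel. norm (s n z) \<le> (B * cmod v) * indicat_real S z" for n
    proof (intro AE_I2)
      fix z
      show "norm (s n z) \<le> (B * cmod v) * indicat_real S z"
      proof (cases "z \<in> S")
        case True
        have "norm (s n z) = cmod (\<phi> (h n *\<^sub>R v + z) - \<phi> z) / h n"
          using h[of n] by (simp add: s_def divide_inverse)
        also have "\<dots> \<le> B * cmod (h n *\<^sub>R v) / h n"
          using B(2)[of "h n *\<^sub>R v + z" z] h[of n] by (intro divide_right_mono) auto
        also have "\<dots> = B * cmod v"
          using h[of n] by simp
        finally show ?thesis using True by simp
      next
        case False
        then have z: "cmod z > R + cmod v" by (simp add: S_def)
        have "cmod (h n *\<^sub>R v) \<le> cmod v"
          using h[of n] by (simp add: mult_left_le_one_le)
        then have "cmod (h n *\<^sub>R v + z) > R"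
          using z norm_triangle_ineq4[of "h n *\<^sub>R v + z" "h n *\<^sub>R v"] by simp
        moreover have "cmod z > R" using z norm_ge_zero[of v] by linarith
        ultimately have "\<phi> (h n *\<^sub>R v + z) = 0" "\<phi> z = 0"
          using K R by (meson not_le)+
        then show ?thesis using False by (simp add: s_def)
      qed
    qed
  qed (unfold s_def, measurable)
  moreover have "(\<integral>z. s n z \<partial>lborel) = 0" for n
    unfolding s_def using integral_lborel_translation[OF int\<phi>, of "h n *\<^sub>R v"] int\<phi> by simp
  ultimately show ?thesis
    by (simp add: LIMSEQ_const_iff)
qed

text \<open>Test functions are zero off \<open>\<Omega>\<close>, so integrals over
  \<open>\<Omega>\<close> can be computed over the plane with \<open>lborel\<close>, where
  translation invariance is at hand.\<close>

lemma integral_lebesgue_on_test_fun: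
  assumes \<Omega>: "\<Omega> \<in> sets lebesgue" and \<phi>: "\<phi> \<in> test_fun \<Omega>"
  shows "integrable (lebesgue_on \<Omega>) \<phi>"
    and "(LINT z|lebesgue_on \<Omega>. \<phi> z) = (\<integral>z. \<phi> z \<partial>lborel)"
proof -
  obtain K where K: "K \<subseteq> \<Omega>" "\<And>z. z \<notin> K \<Longrightarrow> \<phi> z = 0"
    using \<phi> unfolding test_fun_iff by metis
  then have "indicator \<Omega> z *\<^sub>R \<phi> z = \<phi> z" for z
    by (cases "z \<in> \<Omega>") auto
  then have eq: "(\<lambda>z. indicator \<Omega> z *\<^sub>R \<phi> z) = \<phi>"
    by blast
  show "integrable (lebesgue_on \<Omega>) \<phi>"
    using \<Omega> test_fun_integrable_lborel[OF \<phi>] test_fun_borel[OF \<phi>]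
    by (simp add: integrable_restrict_space eq integrable_completion)
  show "(LINT z|lebesgue_on \<Omega>. \<phi> z) = (\<integral>z. \<phi> z \<partial>lborel)"
    using \<Omega> test_fun_borel[OF \<phi>]
    by (simp add: integral_restrict_space eq integral_completion)
qed

lemma integrable_imp_L1loc:
  assumes "\<Omega> \<in> sets lebesgue" and "integrable (lebesgue_on \<Omega>) f"
  shows "f \<in> L1loc_fun \<Omega>"
  unfolding L1loc_fun_def
proof safe
  fix K assume K: "compact K" "K \<subseteq> \<Omega>"
  have Ks: "K \<in> sets lebesgue"
    using K by (simp add: compact_imp_closed)
  have "integrable lebesgue (\<lambda>z. indicator K z *\<^sub>R (indicator \<Omega> z *\<^sub>R f z))"
    by (rule integrable_mult_indicator) (use assms Ks in \<open>simp_all add: integrable_restrict_space\<close>)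
  also have "(\<lambda>z. indicator K z *\<^sub>R (indicator \<Omega> z *\<^sub>R f z)) = (\<lambda>z. indicator K z *\<^sub>R f z)"
  proof
    show "indicator K z *\<^sub>R (indicator \<Omega> z *\<^sub>R f z) = indicator K z *\<^sub>R f z" for z
      using K by (cases "z \<in> K") auto
  qed
  finally show "integrable (lebesgue_on K) f"
    using Ks by (simp add: integrable_restrict_space)
qed

text \<open>Integration by parts: the derivative of the product of the test functions
  \<open>\<phi>\<close> and \<open>\<psi>\<close> has integral 0, and the product rule splits
  it.\<close>

lemma test_fun_weak_pderiv_dir:
  assumes \<Omega>: "\<Omega> \<in> sets lebesgue" and \<phi>: "\<phi> \<in> test_fun \<Omega>"
  shows "weak_pderiv_dir v \<Omega> \<phi> (pderiv_dir v \<phi>)"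
  unfolding weak_pderiv_dir_def
proof (intro conjI ballI)
  show "pderiv_dir v \<phi> \<in> L1loc_fun \<Omega>"
    by (intro integrable_imp_L1loc \<Omega> integral_lebesgue_on_test_fun test_fun_pderiv_dir \<phi>)
next
  fix \<psi> assume \<psi>: "\<psi> \<in> test_fun \<Omega>"
  have "0 = (\<integral>z. pderiv_dir v (\<lambda>z. \<phi> z * \<psi> z) z \<partial>lborel)"
    by (rule integral_pderiv_dir_eq_0[OF test_fun_mult[OF \<phi> \<psi>], symmetric])
  also have "\<dots> = (LINT z|lebesgue_on \<Omega>. pderiv_dir v (\<lambda>z. \<phi> z * \<psi> z) z)"
    by (rule integral_lebesgue_on_test_fun(2)[symmetric]) (intro \<Omega> test_fun_pderiv_dir test_fun_mult \<phi> \<psi>)+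
  also have "\<dots> = (LINT z|lebesgue_on \<Omega>. \<phi> z * pderiv_dir v \<psi> z + pderiv_dir v \<phi> z * \<psi> z)"
    by (simp only: pderiv_dir_mult[OF \<phi> \<psi>])
  also have "\<dots> = (LINT z|lebesgue_on \<Omega>. \<phi> z * pderiv_dir v \<psi> z) + (LINT z|lebesgue_on \<Omega>. pderiv_dir v \<phi> z * \<psi> z)"
    by (intro Bochner_Integration.integral_add integral_lebesgue_on_test_fun \<Omega> test_fun_mult test_fun_pderiv_dir \<phi> \<psi>)
  finally show "(LINT z|lebesgue_on \<Omega>. \<phi> z * pderiv_dir v \<psi> z) = - (LINT z|lebesgue_on \<Omega>. pderiv_dir v \<phi> z * \<psi> z)"
    by (simp add: eq_neg_iff_add_eq_0)
qed

subsection \<open>The fundamental lemma of the calculus of variations\<close>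

text \<open>The functions \<open>p (1/t) exp (-1/t)\<close> with \<open>p\<close> a polynomial, extended by 0, are closed under
  differentiation; this gives smoothness of \<open>exp (-1/t)\<close> at 0.\<close>
definition flat :: "real poly \<Rightarrow> real \<Rightarrow> real" where
  "flat p t = (if t \<le> 0 then 0 else poly p (1 / t) * exp (- (1 / t)))"

text \<open>With \<open>x = 1/t\<close>, the derivative of \<open>p(x) exp(-x)\<close> in
  \<open>t\<close> is \<open>x^2 (p(x) - p'(x)) exp(-x)\<close>; the polynomial
  \<open>[:0, 0, 1:]\<close> is the chain rule factor \<open>x^2\<close>.\<close>

definition flat_pderiv :: "real poly \<Rightarrow> real poly" where
  "flat_pderiv p = [:0, 0, 1:] * (p - pderiv p)"

lemma poly_div_exp_tendsto_0: "((\<lambda>x::real. poly p x * exp (- x)) \<longlongrightarrow> 0) at_top"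
proof -
  have "((\<lambda>x. \<Sum>i\<le>degree p. coeff p i * (x ^ i / exp x)) \<longlongrightarrow> (\<Sum>i\<le>degree p. coeff p i * 0)) at_top"
    by (intro tendsto_intros tendsto_power_div_exp_0)
  moreover have "(\<Sum>i\<le>degree p. coeff p i * (x ^ i / exp x)) = poly p x * exp (- x)" for x
    by (simp add: poly_altdef sum_distrib_right exp_minus divide_inverse mult.assoc)
  ultimately show ?thesis by simp
qed

lemma flat_has_derivative:
  "(flat p has_real_derivative flat (flat_pderiv p) t) (at t)"
proof -
  consider "t < 0" | "t = 0" | "t > 0" by linarith
  then show ?thesis
  proof cases
    case 1
    have "((\<lambda>_. 0) has_real_derivative flat (flat_pderiv p) t) (at t)"
      using 1 by (simp add: flat_def)
    then show ?thesis
      by (rule has_field_derivative_transform_within_open[of _ _ _ "{..<0}"]) (use 1 in \<open>auto simp: flat_def\<close>)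
  next
    case 2
    have "((\<lambda>h. flat p h / h) \<longlongrightarrow> 0) (at 0)"
    proof (rule filterlim_split_at)
      show "((\<lambda>h. flat p h / h) \<longlongrightarrow> 0) (at_left 0)"
        by (rule tendsto_eventually) (auto simp: eventually_at_filter flat_def)
      \<comment> \<open>With \<open>x = inverse h\<close> the quotient \<open>flat p h / h\<close>
        is \<open>x * poly p x * exp (- x)\<close>, and \<open>pCons 0 p\<close> is \<open>p\<close>
        multiplied by the variable.\<close>
      have "((\<lambda>h. poly (pCons 0 p) (inverse h) * exp (- inverse h)) \<longlongrightarrow> 0) (at_right 0)"
        by (rule filterlim_compose[OF poly_div_exp_tendsto_0 filterlim_inverse_at_top_right])
      then show "((\<lambda>h. flat p h / h) \<longlongrightarrow> 0) (at_right 0)"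
        by (rule Lim_transform_eventually)
           (auto simp: eventually_at_filter flat_def divide_inverse mult_ac)
    qed
    then show ?thesis
      using 2 by (simp add: has_field_derivative_iff flat_def)
  next
    case 3
    have "((\<lambda>t. poly p (1 / t) * exp (- (1 / t))) has_real_derivative flat (flat_pderiv p) t) (at t)"
      using 3 by (auto intro!: derivative_eq_intros simp: flat_def flat_pderiv_def field_simps power2_eq_square)
    then show ?thesis
      by (rule has_field_derivative_transform_within_open[of _ _ _ "{0<..}"]) (use 3 in \<open>auto simp: flat_def\<close>)
  qed
qed

text \<open>All \<open>p\<close> are treated at once, because each derivative is a constant times a
  member of the same family with another polynomial.\<close>

lemma C_k_flat: "C_k k (\<lambda>z. of_real (flat p (z \<bullet> u - c)))"
proof (induction k arbitrary: p)
  case 0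
  have "continuous_on UNIV (flat p)"
    using flat_has_derivative DERIV_isCont continuous_at_imp_continuous_on by blast
  then have "continuous_on UNIV (\<lambda>z. flat p (z \<bullet> u - c))"
    by (rule continuous_on_compose2) (auto intro!: continuous_intros)
  then show ?case by (auto intro: continuous_intros)
next
  case (Suc k)
  show ?case
  proof (rule C_k_SucI[where f'="\<lambda>v z. of_real (v \<bullet> u) * of_real (flat (flat_pderiv p) (z \<bullet> u - c))"])
    fix z
    have "((\<lambda>z. flat p (z \<bullet> u - c)) has_derivative (\<lambda>v. (v \<bullet> u) * flat (flat_pderiv p) (z \<bullet> u - c))) (at z)"
      by (rule has_derivative_eq_rhs[OF has_derivative_compose[OF _ flat_has_derivative[unfolded has_field_derivative_def]]])
         (auto intro!: derivative_eq_intros)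
    then show "((\<lambda>z. of_real (flat p (z \<bullet> u - c))) has_derivative
        (\<lambda>v. complex_of_real (v \<bullet> u) * of_real (flat (flat_pderiv p) (z \<bullet> u - c)))) (at z)"
      unfolding of_real_mult[symmetric] by (rule has_derivative_of_real)
  qed (intro C_k_mult C_k_const Suc.IH)+
qed

section \<open>Smooth approximation of the indicator of a box\<close>

text \<open>\<open>flat 1 t\<close> is \<open>exp (- (1 / t))\<close> for positive \<open>t\<close>.
  The four factors cut out the half planes to the right of \<open>Re a\<close>, to the left of
  \<open>Re b\<close>, above \<open>Im a\<close> and below \<open>Im b\<close>.\<close>

definition bump :: "complex \<Rightarrow> complex \<Rightarrow> complex \<Rightarrow> real" where
  "bump a b z = flat 1 (z \<bullet> 1 - Re a) * flat 1 (z \<bullet> (-1) - (- Re b))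
              * (flat 1 (z \<bullet> \<i> - Im a) * flat 1 (z \<bullet> (-\<i>) - (- Im b)))"

lemma flat_1_bounds: "0 \<le> flat 1 t" "flat 1 t \<le> 1" "0 < flat 1 t \<longleftrightarrow> 0 < t"
  by (auto simp: flat_def)

lemma bump_bounds: "0 \<le> bump a b z" "bump a b z \<le> 1"
  unfolding bump_def by (intro mult_nonneg_nonneg mult_le_one flat_1_bounds)+

lemma bump_pos_iff: "0 < bump a b z \<longleftrightarrow> z \<in> box a b"
proof -
  have "0 < x * y \<longleftrightarrow> 0 < x \<and> 0 < y" if "0 \<le> x" "0 \<le> y" for x y :: real
    using that by (auto simp: zero_less_mult_iff)
  then show ?thesis
    by (auto simp: bump_def flat_1_bounds in_box_complex_iff)
qed

text \<open>Takes the place of mollification, and only the positivity set of \<open>bump\<close>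
  matters: on the box \<open>1 - bump\<close> lies in \<open>[0, 1)\<close>, so its powers tend to
  0, and off the box it is 1.\<close>

lemma bump_tendsto_indicator:
  "(\<lambda>n. 1 - (1 - bump a b z) ^ n) \<longlonglongrightarrow> indicator (box a b) z"
proof (cases "z \<in> box a b")
  case True
  then have "(\<lambda>n. 1 - (1 - bump a b z) ^ n) \<longlonglongrightarrow> 1 - 0"
    using bump_bounds[of a b z] bump_pos_iff[of a b z]
    by (intro tendsto_intros LIMSEQ_power_zero) auto
  with True show ?thesis by simp
next
  case False
  then have "bump a b z = 0"
    using bump_bounds[of a b z] bump_pos_iff[of a b z] by auto
  with False show ?thesis by simp
qed

lemma test_fun_bump:
  assumes "cbox a b \<subseteq> \<Omega>"
  shows "(\<lambda>z. of_real (1 - (1 - bump a b z) ^ n)) \<in> test_fun \<Omega>"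
proof -
  have "C_k k (\<lambda>z. of_real (bump a b z))" for k
    unfolding bump_def of_real_mult by (intro C_k_mult C_k_flat)
  \<comment> \<open>Differences are written as sums with a factor -1, to fit the closure of
    \<open>C_k\<close> under sums, products and constants.\<close>
  then have 1: "C_k k (\<lambda>z. 1 + (-1) * of_real (bump a b z))" for k
    by (intro C_k_add C_k_mult C_k_const)
  have "C_k k (\<lambda>z. (1 + (-1) * of_real (bump a b z)) ^ n)" for k
    by (induction n) (simp_all only: power_0 power_Suc C_k_const C_k_mult 1)
  then have "C_k k (\<lambda>z. 1 + (-1) * (1 + (-1) * of_real (bump a b z)) ^ n)" for k
    by (intro C_k_add C_k_mult C_k_const)
  then have "C_k k (\<lambda>z. of_real (1 - (1 - bump a b z) ^ n))" for k
    by simp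
  moreover have "of_real (1 - (1 - bump a b z) ^ n) = (0::complex)" if "z \<notin> cbox a b" for z
  proof -
    have "z \<notin> box a b" using that box_subset_cbox by blast
    then have "bump a b z = 0"
      using bump_bounds[of a b z] bump_pos_iff[of a b z] by auto
    then show ?thesis by simp
  qed
  ultimately show ?thesis
    using assms by (auto simp: test_fun_iff intro!: exI[of _ "cbox a b"])
qed

section \<open>From test functions to almost every point\<close>

text \<open>The approximants \<open>\<psi> n\<close> have values in \<open>[0, 1]\<close>, so the
  norm of \<open>h\<close> dominates, and the limit replaces a test function by the indicator of the
  open box. The closed box carries the supports and must therefore lie in
  \<open>\<Omega>\<close>.\<close>

lemma integral_box_eq_0:
  assumes \<Omega>: "\<Omega> \<in> sets lebesgue" and h: "integrable (lebesgue_on \<Omega>) h"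
    and zero: "\<And>\<phi>. \<phi> \<in> test_fun \<Omega> \<Longrightarrow> (LINT z|lebesgue_on \<Omega>. h z * \<phi> z) = 0"
    and box: "cbox a b \<subseteq> \<Omega>"
  shows "(LINT z:box a b|lebesgue. h z) = 0"
proof -
  define \<psi> where "\<psi> n z = 1 - (1 - bump a b z) ^ n" for n z
  have \<psi>01: "0 \<le> \<psi> n z" "\<psi> n z \<le> 1" for n z
    using bump_bounds[of a b z] by (auto simp: \<psi>_def intro: power_le_one)
  have \<psi>t: "(\<lambda>z. of_real (\<psi> n z)) \<in> test_fun \<Omega>" for n
    unfolding \<psi>_def by (rule test_fun_bump[OF box])
  have sub: "box a b \<subseteq> \<Omega>" using box box_subset_cbox by blast
  have [measurable]: "h \<in> borel_measurable (lebesgue_on \<Omega>)"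
    using h by simp
  have m: "(\<lambda>z. of_real (\<psi> n z) :: complex) \<in> borel_measurable (lebesgue_on \<Omega>)" for n
    using integral_lebesgue_on_test_fun(1)[OF \<Omega> \<psi>t[of n]] by (rule borel_measurable_integrable)
  have "(\<lambda>n. LINT z|lebesgue_on \<Omega>. h z * of_real (\<psi> n z)) \<longlonglongrightarrow>
      (LINT z|lebesgue_on \<Omega>. h z * of_real (indicator (box a b) z))"
  proof (rule integral_dominated_convergence[where w="\<lambda>z. norm (h z)"])
    show "AE z in lebesgue_on \<Omega>. (\<lambda>n. h z * of_real (\<psi> n z)) \<longlonglongrightarrow> h z * of_real (indicator (box a b) z)"
      unfolding \<psi>_def by (intro AE_I2 tendsto_intros bump_tendsto_indicator)
    show "AE z in lebesgue_on \<Omega>. norm (h z * of_real (\<psi> n z)) \<le> norm (h z)" for n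
      using \<psi>01 by (intro AE_I2) (simp add: norm_mult mult_left_le)
    show "(\<lambda>z. h z * of_real (indicator (box a b) z)) \<in> borel_measurable (lebesgue_on \<Omega>)"
    proof -
      have "(indicator (box a b) :: complex \<Rightarrow> complex) \<in> borel_measurable lebesgue"
        by (intro borel_measurable_indicator) simp
      also have "(indicator (box a b) :: complex \<Rightarrow> complex) = (\<lambda>z. of_real (indicator (box a b) z))"
        by (simp add: fun_eq_iff indicator_def)
      finally have "(\<lambda>z. of_real (indicator (box a b) z) :: complex) \<in> borel_measurable lebesgue"
        .
      then have "(\<lambda>z. of_real (indicator (box a b) z) :: complex) \<in> borel_measurable (lebesgue_on \<Omega>)"
        by (rule measurable_restrict_space1)
      then show ?thesis by measurable
    qed
  qed (use h m in \<open>auto intro!: borel_measurable_times\<close>)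
  then have "(LINT z|lebesgue_on \<Omega>. h z * of_real (indicator (box a b) z)) = 0"
    by (simp add: zero[OF \<psi>t] LIMSEQ_const_iff)
  also have "(LINT z|lebesgue_on \<Omega>. h z * of_real (indicator (box a b) z))
      = (LINT z|lebesgue. indicator \<Omega> z *\<^sub>R (h z * of_real (indicator (box a b) z)))"
    using \<Omega> by (simp add: integral_restrict_space)
  also have "(\<lambda>z. indicator \<Omega> z *\<^sub>R (h z * of_real (indicator (box a b) z))) = (\<lambda>z. indicator (box a b) z *\<^sub>R h z)"
  proof
    show "indicator \<Omega> z *\<^sub>R (h z * of_real (indicator (box a b) z)) = indicator (box a b) z *\<^sub>R h z" for z
      using sub by (cases "z \<in> box a b") auto
  qed
  finally show ?thesis
    by (simp add: set_lebesgue_integral_def)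
qed

text \<open>A pi-lambda argument: boxes form an intersection-stable generator of the Borel sets, so
  vanishing integrals pass from boxes to Borel sets and then to Lebesgue sets, and an integrable
  function with all these integrals zero vanishes almost everywhere.\<close>

lemma AE_box_eq_0:
  fixes h :: "complex \<Rightarrow> complex"
  assumes h: "set_integrable lebesgue (box a b) h"
    and zero: "\<And>c d. box c d \<noteq> {} \<Longrightarrow> box c d \<subseteq> box a b \<Longrightarrow> (LINT z:box c d|lebesgue. h z) = 0"
  shows "AE z in lebesgue. z \<in> box a b \<longrightarrow> h z = 0"
proof -
  \<comment> \<open>Cutting \<open>h\<close> off makes it integrable over the plane with total
    integral 0, as the complement step of the induction requires.\<close>
  define g where "g z = indicator (box a b) z *\<^sub>R h z" for z
  have g: "integrable lebesgue g"
    using h by (simp add: g_def[abs_def] set_integrable_def)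
  have gA: "set_integrable lebesgue A g" if "A \<in> sets lebesgue" for A
    unfolding set_integrable_def by (rule integrable_mult_indicator[OF that g])
  have g_eq: "(LINT z:A|lebesgue. g z) = (LINT z:A \<inter> box a b|lebesgue. h z)" for A
    by (simp add: set_lebesgue_integral_def g_def indicator_inter_arith)
  have box: "(LINT z:box c d|lebesgue. g z) = 0" for c d
  proof -
    have "(LINT z:box c d \<inter> box a b|lebesgue. h z) = 0"
    proof (cases "box c d \<inter> box a b = {}")
      case False
      obtain c' d' where "box c d \<inter> box a b = box c' d'"
        unfolding box_Int_box by blast
      moreover have "box c d \<inter> box a b \<subseteq> box a b" by blast
      ultimately show ?thesis
        using zero[of c' d'] False by simp
    qed (simp add: set_lebesgue_integral_def)
    then show ?thesis by (simp add: g_eq)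
  qed
  let ?G = "range (\<lambda>(c, d). box c d :: complex set)"
  have sigma: "sigma_sets UNIV ?G = sets borel"
    by (simp add: borel_eq_box)
  have borel: "(LINT z:A|lebesgue. g z) = 0" if "A \<in> sigma_sets UNIV ?G" for A
  proof (rule sigma_sets_induct_disjoint[OF _ _ that, where P="\<lambda>A. (LINT z:A|lebesgue. g z) = 0"])
    show "Int_stable ?G"
      by (auto simp: Int_stable_def box_Int_box)
    show "(LINT z:A|lebesgue. g z) = 0" if "A \<in> ?G" for A
      using that box by auto
    show "(LINT z:{}|lebesgue. g z) = 0"
      by (simp add: set_lebesgue_integral_def)
    show "(LINT z:UNIV - A|lebesgue. g z) = 0"
      if A: "A \<in> sigma_sets UNIV ?G" and 0: "(LINT z:A|lebesgue. g z) = 0" for A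
    proof -
      have As: "A \<in> sets lebesgue" using A sigma by auto
      have "(LINT z:UNIV - A|lebesgue. g z) + (LINT z:A|lebesgue. g z) = (LINT z:(UNIV - A) \<union> A|lebesgue. g z)"
        using As by (intro set_integral_Un[symmetric] gA) auto
      also have "\<dots> = (LINT z:box a b|lebesgue. g z)"
        by (simp add: g_eq)
      finally show ?thesis using 0 box by simp
    qed
    show "(LINT z:\<Union> (range A)|lebesgue. g z) = 0"
      if A: "disjoint_family A" "range A \<subseteq> sigma_sets UNIV ?G" and 0: "\<And>i. (LINT z:A i|lebesgue. g z) = 0" for A :: "nat \<Rightarrow> complex set"
    proof -
      have As: "A i \<in> sets lebesgue" for i using A(2) sigma by auto
      have "(LINT z:\<Union> (range A)|lebesgue. g z) = (\<Sum>i. (LINT z:A i|lebesgue. g z))"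
        using A(1) As by (intro lebesgue_integral_countable_add gA) (auto simp: disjoint_family_on_def)
      then show ?thesis using 0 by simp
    qed
  qed auto
  have leb: "(LINT z:A|lebesgue. g z) = 0" if A: "A \<in> sets lebesgue" for A
  proof -
    \<comment> \<open>A Lebesgue set is a Borel set \<open>S\<close> together with a part
      \<open>N\<close> of a Borel null set, which does not affect the integral.\<close>
    obtain S N N' where S: "A = S \<union> N" "N \<subseteq> N'" "N' \<in> null_sets lborel" "S \<in> sets lborel"
      using A by (rule sets_completionE)
    have "AE z in lebesgue. z \<notin> N'"
      using S by (intro AE_not_in) (auto intro: null_sets_completionI)
    then have "(LINT z:A|lebesgue. g z) = (LINT z:S|lebesgue. g z)"
      unfolding set_lebesgue_integral_def
      by (intro integral_cong_AE borel_measurable_scaleR borel_measurable_indicator)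
         (use S A g in \<open>auto elim!: eventually_mono simp: indicator_def\<close>)
    also have "\<dots> = 0" using S sigma by (intro borel) auto
    finally show ?thesis .
  qed
  interpret B: finite_measure "lebesgue_on (box a b)"
    by (rule finite_measure_lebesgue_on) simp
  have "AE z in lebesgue_on (box a b). h z = 0"
  proof (rule B.density_zero)
    show "integrable (lebesgue_on (box a b)) h"
      using h by (simp add: integrable_restrict_space set_integrable_def)
    fix A assume "A \<in> sets (lebesgue_on (box a b))"
    then have A: "A \<in> sets lebesgue" "A \<subseteq> box a b"
      by (auto simp: sets_restrict_space)
    have "(LINT z:A|lebesgue_on (box a b). h z) = (LINT z|lebesgue. indicator (box a b) z *\<^sub>R (indicator A z *\<^sub>R h z))"
      unfolding set_lebesgue_integral_def by (rule integral_restrict_space) simp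
    also have "\<dots> = (LINT z:A|lebesgue. g z)"
      by (simp add: set_lebesgue_integral_def g_def mult.commute)
    finally show "(LINT z:A|lebesgue_on (box a b). h z) = 0"
      using leb[OF A(1)] by simp
  qed
  then show ?thesis
    by (simp add: AE_restrict_space_iff)
qed

text \<open>An open set is a countable union of closed boxes. On each of them the open box is
  settled by the previous lemmas and the faces are null; countability lets the exceptional sets be
  collected.\<close>

lemma test_fun_AE_eq_0:
  fixes h :: "complex \<Rightarrow> complex"
  assumes \<Omega>: "open \<Omega>" and h: "integrable (lebesgue_on \<Omega>) h"
    and zero: "\<And>\<phi>. \<phi> \<in> test_fun \<Omega> \<Longrightarrow> (LINT z|lebesgue_on \<Omega>. h z * \<phi> z) = 0"
  shows "AE z in lebesgue_on \<Omega>. h z = 0"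
proof -
  have \<Omega>s: "\<Omega> \<in> sets lebesgue" using \<Omega> by simp
  obtain D where D: "countable D" "D \<subseteq> Pow \<Omega>" "\<And>X. X \<in> D \<Longrightarrow> \<exists>a b. X = cbox a b" "\<Union>D = \<Omega>"
    using open_countable_Union_open_cbox[OF \<Omega>] by metis
  have "AE z in lebesgue. z \<in> X \<longrightarrow> h z = 0" if XD: "X \<in> D" for X
  proof -
    obtain a b where "X = cbox a b"
      using D(3)[OF XD] by blast
    with D(2) XD have X: "X = cbox a b" "cbox a b \<subseteq> \<Omega>"
      by auto
    have sub: "box a b \<subseteq> \<Omega>" using X box_subset_cbox by blast
    have "set_integrable lebesgue (box a b) h"
      by (rule set_integrable_subset[of _ \<Omega>]) (use h \<Omega>s sub in \<open>auto simp: set_integrable_def integrable_restrict_space\<close>)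
    moreover have "(LINT z:box c d|lebesgue. h z) = 0" if "box c d \<noteq> {}" "box c d \<subseteq> box a b" for c d
    proof (rule integral_box_eq_0[OF \<Omega>s h zero])
      \<comment> \<open>Nonemptiness of the open box makes \<open>cbox c d\<close> its closure; a
        degenerate closed box could lie outside \<open>cbox a b\<close>.\<close>
      have "cbox c d = closure (box c d)"
        using that by (simp add: closure_box)
      also have "\<dots> \<subseteq> cbox a b"
        using that box_subset_cbox by (intro closure_minimal) auto
      finally show "cbox c d \<subseteq> \<Omega>" using X by auto
    qed
    ultimately have 1: "AE z in lebesgue. z \<in> box a b \<longrightarrow> h z = 0"
      by (rule AE_box_eq_0)
    have "AE z in lebesgue. z \<notin> cbox a b - box a b"
      using negligible_frontier_interval[of a b] by (intro AE_not_in) (simp add: negligible_iff_null_sets)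
    with 1 show ?thesis
      by eventually_elim (auto simp: X)
  qed
  then have "AE z in lebesgue. \<forall>X\<in>D. z \<in> X \<longrightarrow> h z = 0"
    unfolding AE_ball_countable[OF D(1)] by blast
  then show ?thesis
    using \<Omega>s D(4) by (auto simp: AE_restrict_space_iff elim!: eventually_mono)
qed

subsection \<open>Bicomplex components\<close>

lemma bicomplex_sel_simps [simp]:
  "Sc 0 = 0" "Vec 0 = 0" "Sc 1 = 1" "Vec 1 = 0"
  "Sc (W + V) = Sc W + Sc V" "Vec (W + V) = Vec W + Vec V"
  "Sc (W - V) = Sc W - Sc V" "Vec (W - V) = Vec W - Vec V"
  "Sc (- W) = - Sc W" "Vec (- W) = - Vec W"
  "Sc (W * V) = Sc W * Sc V - Vec W * Vec V" "Vec (W * V) = Sc W * Vec V + Vec W * Sc V"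
  "Sc (bc_of_complex c) = c" "Vec (bc_of_complex c) = 0" "Sc bc_j = 0" "Vec bc_j = 1"
  "Sc (bc_bar W) = Sc W" "Vec (bc_bar W) = - Vec W"
  "Sc (bc_star W) = cnj (Sc W)" "Vec (bc_star W) = cnj (Vec W)"
  "Sc (bc_dagger W) = cnj (Sc W)" "Vec (bc_dagger W) = - cnj (Vec W)"
  by (simp_all add: zero_bicomplex_def one_bicomplex_def plus_bicomplex_def minus_bicomplex_def
      uminus_bicomplex_def times_bicomplex_def bc_of_complex_def bc_j_def bc_bar_def bc_star_def bc_dagger_def)

lemma bc_integral_sel [simp]:
  "Sc (bc_integral \<Omega> F) = (LINT z|lebesgue_on \<Omega>. Sc (F z))"
  "Vec (bc_integral \<Omega> F) = (LINT z|lebesgue_on \<Omega>. Vec (F z))"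
  by (simp_all add: bc_integral_def)

lemma bc_components_in_iff:
  "F \<in> bc_components_in S \<longleftrightarrow> (\<lambda>z. Sc (F z)) \<in> S \<and> (\<lambda>z. Vec (F z)) \<in> S"
  by (simp add: bc_components_in_def)

text \<open>Pairs of complex numbers form a Euclidean space, so norm, measurability and the results
  on \<open>l2\<close> become available; its real inner product is the real part of
  \<open>bc_inner\<close>.\<close>

definition bc_pair :: "bicomplex \<Rightarrow> complex \<times> complex" where
  "bc_pair W = (Sc W, Vec W)"

lemma bc_pair_simps:
  "bc_pair (W + V) = bc_pair W + bc_pair V" "bc_pair (W - V) = bc_pair W - bc_pair V"
  "bc_pair (bc_of_complex (of_real r) * W) = r *\<^sub>R bc_pair W" "bc_pair 0 = 0"
  by (simp_all add: bc_pair_def scaleR_conv_of_real zero_prod_def)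

lemma inner_bc_pair: "bc_pair W \<bullet> bc_pair V = Re (bc_inner W V)"
  by (simp add: bc_pair_def bc_inner_def inner_complex_def)

lemma bc_inner_self: "bc_inner W W = of_real ((norm (bc_pair W))\<^sup>2)"
  unfolding power2_norm_eq_inner inner_bc_pair
  by (simp add: bc_inner_def complex_eq_iff)

lemma bc_L2_norm_eq: "bc_L2_norm \<Omega> F = l2_norm (lebesgue_on \<Omega>) (\<lambda>z. bc_pair (F z))"
  by (simp add: bc_L2_norm_def bc_L2_inner_def l2_norm_def bc_inner_self del: of_real_power)

text \<open>Explains the shape of the adjoint operator. Multiplication by \<open>B\<close> has the
  adjoint multiplication by \<open>bc_dagger B\<close>, and \<open>bc_bar\<close> is self-adjoint;
  moving \<open>bc_bar\<close> past \<open>bc_dagger B\<close> leaves the coefficient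
  \<open>bc_bar (bc_dagger B)\<close>, which is \<open>bc_star B\<close>.\<close>

lemma bc_inner_adjoint:
  "bc_inner W (bc_dagger A * \<Phi> + bc_star B * bc_bar \<Phi>) = bc_inner (A * W + B * bc_bar W) \<Phi>"
  by (simp add: bc_inner_def algebra_simps)

text \<open>Converts the Hermitian product into the bilinear one of the weak equation, of which it
  sees the scalar part.\<close>

lemma bc_inner_dagger: "bc_inner W V = Sc (W * bc_dagger V)"
  by (simp add: bc_inner_def)

lemma Sc_mult_dagger: "Re (Sc (bc_dagger X * X)) = (cmod (Sc X))\<^sup>2 + (cmod (Vec X))\<^sup>2"
  unfolding cmod_power2 by (simp add: power2_eq_square)

section \<open>L2 functions and L2 convergence by components\<close>

lemma l2_mult_integrable:
  fixes f g :: "'a \<Rightarrow> complex"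
  assumes f: "f \<in> l2 M" and g: "g \<in> l2 M"
  shows "integrable M (\<lambda>x. f x * g x)"
proof -
  have n: "(\<lambda>x. norm (f x)) \<in> l2 M" "(\<lambda>x. norm (g x)) \<in> l2 M"
    by (rule l2_bound[OF f, where C=1], use l2_measurable[OF f] in auto,
        rule l2_bound[OF g, where C=1], use l2_measurable[OF g] in auto)
  have "integrable M (\<lambda>x. norm (f x) * norm (g x))"
    using l2_inner_integrable[OF n] by simp
  then show ?thesis
    by (rule integrable_dominated)
       (use l2_measurable[OF f] l2_measurable[OF g] in \<open>auto simp: norm_mult\<close>)
qed

lemma l2_cmult: "f \<in> l2 M \<Longrightarrow> (\<lambda>x. c * f x) \<in> l2 M" for c :: complex
  by (rule l2_bound[where C="cmod c" and g=f]) (auto simp: norm_mult)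

lemma l2_cnj_iff [simp]: "(\<lambda>x. cnj (f x)) \<in> l2 M \<longleftrightarrow> f \<in> l2 M"
proof -
  have cnj: "cnj \<in> borel_measurable borel"
    by (intro borel_measurable_continuous_onI continuous_on_cnj continuous_on_id)
  have "(\<lambda>x. cnj (f x)) \<in> borel_measurable M \<longleftrightarrow> f \<in> borel_measurable M"
    using measurable_compose[OF _ cnj, of f M] measurable_compose[OF _ cnj, of "\<lambda>x. cnj (f x)" M]
    unfolding complex_cnj_cnj by blast
  then show ?thesis by (simp add: l2_def)
qed

lemma l2_Pair_iff: "(\<lambda>x. (f x, g x)) \<in> l2 M \<longleftrightarrow> f \<in> l2 M \<and> g \<in> l2 M"
proof
  assume *: "(\<lambda>x. (f x, g x)) \<in> l2 M"
  have "f \<in> borel_measurable M" "g \<in> borel_measurable M"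
    using measurable_compose[OF l2_measurable[OF *] borel_measurable_continuous_onI[of fst]]
      measurable_compose[OF l2_measurable[OF *] borel_measurable_continuous_onI[of snd]]
    by (simp_all add: continuous_on_fst continuous_on_snd)
  then show "f \<in> l2 M \<and> g \<in> l2 M"
    by (auto intro!: l2_bound[OF *, where C=1] simp: norm_Pair real_le_rsqrt)
next
  assume "f \<in> l2 M \<and> g \<in> l2 M"
  then show "(\<lambda>x. (f x, g x)) \<in> l2 M"
    by (auto simp: l2_def norm_Pair)
qed

text \<open>Membership in \<open>l2\<close> is part of the notion because the integral of a
  non-integrable function is 0 by default, so a small \<open>l2_norm\<close> alone would say
  nothing.\<close>

definition l2_tendsto where
  "l2_tendsto M G H \<longleftrightarrow> (\<forall>n::nat. G n \<in> l2 M) \<and> H \<in> l2 M \<and>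
     (\<lambda>n. l2_norm M (\<lambda>x. G n x - H x)) \<longlonglongrightarrow> 0"

lemma l2_tendsto_add:
  assumes "l2_tendsto M G H" "l2_tendsto M G' H'"
  shows "l2_tendsto M (\<lambda>n x. G n x + G' n x) (\<lambda>x. H x + H' x)"
  unfolding l2_tendsto_def
proof (intro conjI allI)
  note a = assms[unfolded l2_tendsto_def]
  show "(\<lambda>x. G n x + G' n x) \<in> l2 M" "(\<lambda>x. H x + H' x) \<in> l2 M" for n
    using a by (auto intro: l2_add)
  show "(\<lambda>n. l2_norm M (\<lambda>x. G n x + G' n x - (H x + H' x))) \<longlonglongrightarrow> 0"
  proof (rule Lim_null_comparison[OF always_eventually])
    show "\<forall>n. norm (l2_norm M (\<lambda>x. G n x + G' n x - (H x + H' x)))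
        \<le> l2_norm M (\<lambda>x. G n x - H x) + l2_norm M (\<lambda>x. G' n x - H' x)"
    proof
      fix n
      show "norm (l2_norm M (\<lambda>x. G n x + G' n x - (H x + H' x)))
        \<le> l2_norm M (\<lambda>x. G n x - H x) + l2_norm M (\<lambda>x. G' n x - H' x)"
        using l2_norm_triangle[of "\<lambda>x. G n x - H x" M "\<lambda>x. G' n x - H' x"] a
        by (simp add: l2_diff add_diff_add)
    qed
    show "(\<lambda>n. l2_norm M (\<lambda>x. G n x - H x) + l2_norm M (\<lambda>x. G' n x - H' x)) \<longlonglongrightarrow> 0"
      using a by (auto intro: tendsto_add_zero)
  qed
qed

lemma l2_tendsto_cmult:
  fixes c :: complex
  assumes "l2_tendsto M G H"
  shows "l2_tendsto M (\<lambda>n x. c * G n x) (\<lambda>x. c * H x)"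
proof -
  have "l2_norm M (\<lambda>x. c * G n x - c * H x) = cmod c * l2_norm M (\<lambda>x. G n x - H x)" for n
    by (rule l2_norm_cmult) (simp_all add: norm_mult flip: right_diff_distrib)
  with assms show ?thesis
    by (auto simp: l2_tendsto_def l2_cmult intro: tendsto_mult_right_zero)
qed

text \<open>The pair is the sum of \<open>(G n x, 0)\<close> and \<open>(0, G' n x)\<close>, whose
  norms are those of the components.\<close>

lemma l2_tendsto_Pair:
  assumes "l2_tendsto M G H" "l2_tendsto M G' H'"
  shows "l2_tendsto M (\<lambda>n x. (G n x, G' n x)) (\<lambda>x. (H x, H' x))"
proof -
  have "l2_tendsto M (\<lambda>n x. (G n x, 0)) (\<lambda>x. (H x, 0))"
    using assms(1) by (auto simp: l2_tendsto_def l2_Pair_iff l2_norm_def norm_Pair)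
  moreover have "l2_tendsto M (\<lambda>n x. (0, G' n x)) (\<lambda>x. (0, H' x))"
    using assms(2) by (auto simp: l2_tendsto_def l2_Pair_iff l2_norm_def norm_Pair)
  ultimately show ?thesis
    using l2_tendsto_add[of M "\<lambda>n x. (G n x, 0)" "\<lambda>x. (H x, 0)" "\<lambda>n x. (0, G' n x)" "\<lambda>x. (0, H' x)"]
    by simp
qed

subsection \<open>Bicomplex functions on a bounded open set\<close>

locale bounded_open_set =
  fixes \<Omega> :: "complex set"
  assumes open_\<Omega>: "open \<Omega>" and bounded_\<Omega>: "bounded \<Omega>"
begin

abbreviation "M \<equiv> lebesgue_on \<Omega>"
abbreviation "BL2 \<equiv> bc_components_in (L2_fun \<Omega>)"
abbreviation "BLinf \<equiv> bc_components_in (Linf_fun \<Omega>)"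
abbreviation "Btest \<equiv> bc_components_in (test_fun \<Omega>)"
abbreviation "BW012 \<equiv> bc_components_in (W012_fun \<Omega>)"

lemma sets_\<Omega>: "\<Omega> \<in> sets lebesgue"
  using open_\<Omega> by simp

lemma finite_measure_M: "finite_measure M"
proof (rule finite_measure_lebesgue_on)
  show "\<Omega> \<in> lmeasurable"
    using open_\<Omega> bounded_\<Omega> by (rule lmeasurable_open[rotated])
qed

lemma L2_fun_eq: "L2_fun \<Omega> = l2 M"
  by (simp add: L2_fun_def l2_def)

lemma L2_norm_fun_eq: "L2_norm_fun \<Omega> f = l2_norm M f"
  by (simp add: L2_norm_fun_def l2_norm_def)

lemma BL2_iff: "F \<in> BL2 \<longleftrightarrow> (\<lambda>z. bc_pair (F z)) \<in> l2 M"
  by (simp add: bc_components_in_iff L2_fun_eq bc_pair_def l2_Pair_iff)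

lemma BL2_sel: "F \<in> BL2 \<Longrightarrow> (\<lambda>z. Sc (F z)) \<in> l2 M" "F \<in> BL2 \<Longrightarrow> (\<lambda>z. Vec (F z)) \<in> l2 M"
  by (simp_all add: bc_components_in_iff L2_fun_eq)

lemma test_fun_l2:
  assumes \<phi>: "\<phi> \<in> test_fun \<Omega>"
  shows "\<phi> \<in> l2 M"
proof -
  interpret finite_measure M by (rule finite_measure_M)
  obtain B where "\<And>z. cmod (\<phi> z) \<le> B"
    using test_fun_bounded[OF \<phi>] by blast
  then show ?thesis
    by (intro l2_bound[of "\<lambda>_. 1::real" M \<phi> B] borel_measurable_integrable
          integral_lebesgue_on_test_fun(1)[OF sets_\<Omega> \<phi>]) (auto simp: l2_def)
qed

lemma l2_imp_L1loc: "f \<in> l2 M \<Longrightarrow> f \<in> L1loc_fun \<Omega>"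
  by (intro integrable_imp_L1loc sets_\<Omega> l2_imp_integrable finite_measure_M)

lemma BL2_imp_L1loc: "F \<in> BL2 \<Longrightarrow> F \<in> bc_components_in (L1loc_fun \<Omega>)"
  by (simp add: bc_components_in_iff L2_fun_eq l2_imp_L1loc)

lemma l2_mult_Linf:
  assumes c: "c \<in> Linf_fun \<Omega>" and f: "f \<in> l2 M"
  shows "(\<lambda>z. c z * f z) \<in> l2 M"
proof -
  obtain C where "AE z in M. cmod (c z) \<le> C" and [measurable]: "c \<in> borel_measurable M"
    using c by (auto simp: Linf_fun_def)
  then show ?thesis
    using l2_measurable[OF f]
    by (intro l2_bound[OF f, of _ C]) (auto simp: norm_mult elim!: eventually_mono intro: mult_right_mono)
qed

lemma BL2_zero: "(\<lambda>z. 0) \<in> BL2"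
  by (simp add: bc_components_in_iff L2_fun_eq)

lemma BL2_add: "F \<in> BL2 \<Longrightarrow> G \<in> BL2 \<Longrightarrow> (\<lambda>z. F z + G z) \<in> BL2"
  by (simp add: bc_components_in_iff L2_fun_eq l2_add)

lemma BL2_diff: "F \<in> BL2 \<Longrightarrow> G \<in> BL2 \<Longrightarrow> (\<lambda>z. F z - G z) \<in> BL2"
  by (simp add: bc_components_in_iff L2_fun_eq l2_diff)

lemma BL2_cmult: "F \<in> BL2 \<Longrightarrow> (\<lambda>z. W * F z) \<in> BL2"
  by (simp add: bc_components_in_iff L2_fun_eq l2_cmult l2_add l2_diff)

lemma BL2_mult_Linf: "A \<in> BLinf \<Longrightarrow> F \<in> BL2 \<Longrightarrow> (\<lambda>z. A z * F z) \<in> BL2"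
  by (simp add: bc_components_in_iff L2_fun_eq l2_mult_Linf l2_add l2_diff)

lemma BL2_bar: "F \<in> BL2 \<Longrightarrow> (\<lambda>z. bc_bar (F z)) \<in> BL2"
  by (simp add: bc_components_in_iff L2_fun_eq l2_minus)

lemma Linf_cnj: "c \<in> Linf_fun \<Omega> \<Longrightarrow> (\<lambda>z. cnj (c z)) \<in> Linf_fun \<Omega>"
  and Linf_minus: "c \<in> Linf_fun \<Omega> \<Longrightarrow> (\<lambda>z. - c z) \<in> Linf_fun \<Omega>"
proof -
  have cnj: "cnj \<in> borel_measurable borel"
    by (intro borel_measurable_continuous_onI continuous_on_cnj continuous_on_id)
  show "c \<in> Linf_fun \<Omega> \<Longrightarrow> (\<lambda>z. cnj (c z)) \<in> Linf_fun \<Omega>"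
    using measurable_compose[OF _ cnj] by (auto simp: Linf_fun_def)
  show "c \<in> Linf_fun \<Omega> \<Longrightarrow> (\<lambda>z. - c z) \<in> Linf_fun \<Omega>"
    by (auto simp: Linf_fun_def)
qed

lemma BLinf_dagger: "A \<in> BLinf \<Longrightarrow> (\<lambda>z. bc_dagger (A z)) \<in> BLinf"
  and BLinf_star: "A \<in> BLinf \<Longrightarrow> (\<lambda>z. bc_star (A z)) \<in> BLinf"
  by (simp_all add: bc_components_in_iff Linf_cnj Linf_minus)

lemma BL2_mult_integrable:
  assumes "F \<in> BL2" "G \<in> BL2"
  shows "integrable M (\<lambda>z. Sc (F z * G z))" "integrable M (\<lambda>z. Vec (F z * G z))"
    and "integrable M (\<lambda>z. bc_inner (F z) (G z))"
  using assms by (simp_all add: bc_inner_def BL2_sel l2_mult_integrable)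

lemma Btest_BL2: "\<phi> \<in> Btest \<Longrightarrow> \<phi> \<in> BL2"
  by (simp add: bc_components_in_iff L2_fun_eq test_fun_l2)

section \<open>Cauchy-Riemann operators on test functions\<close>

lemma bc_d_sel:
  "Sc (bc_d \<phi> z) = (pderiv_dir 1 (\<lambda>z. Sc (\<phi> z)) z + pderiv_dir \<i> (\<lambda>z. Vec (\<phi> z)) z) / 2"
  "Vec (bc_d \<phi> z) = (pderiv_dir 1 (\<lambda>z. Vec (\<phi> z)) z - pderiv_dir \<i> (\<lambda>z. Sc (\<phi> z)) z) / 2"
  "Sc (bc_dbar \<phi> z) = (pderiv_dir 1 (\<lambda>z. Sc (\<phi> z)) z - pderiv_dir \<i> (\<lambda>z. Vec (\<phi> z)) z) / 2"
  "Vec (bc_dbar \<phi> z) = (pderiv_dir 1 (\<lambda>z. Vec (\<phi> z)) z + pderiv_dir \<i> (\<lambda>z. Sc (\<phi> z)) z) / 2"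
  by (simp_all add: bc_d_def bc_dbar_def bc_pderiv_dir_def)

lemma l2_half: "f \<in> l2 M \<Longrightarrow> (\<lambda>z. f z / 2) \<in> l2 M" for f :: "complex \<Rightarrow> complex"
  using l2_cmult[of f M "1/2"] by simp

lemma Btest_d: "\<phi> \<in> Btest \<Longrightarrow> bc_d \<phi> \<in> BL2" and Btest_dbar: "\<phi> \<in> Btest \<Longrightarrow> bc_dbar \<phi> \<in> BL2"
  by (simp_all add: bc_components_in_iff L2_fun_eq bc_d_sel l2_half l2_add l2_diff test_fun_l2 test_fun_pderiv_dir)

lemma Btest_dagger: "\<phi> \<in> Btest \<Longrightarrow> (\<lambda>z. bc_dagger (\<phi> z)) \<in> Btest"
  by (simp add: bc_components_in_iff test_fun_cnj test_fun_uminus)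

text \<open>\<open>bc_dagger\<close> is multiplicative, commutes with partial derivatives and
  negates \<open>bc_j\<close>, so it exchanges the two operators.\<close>

lemma bc_d_dagger: "\<phi> \<in> Btest \<Longrightarrow> bc_dagger (bc_d \<phi> z) = bc_dbar (\<lambda>z. bc_dagger (\<phi> z)) z"
  by (simp add: bicomplex_eq_iff bc_d_sel bc_components_in_iff pderiv_dir_cnj[where \<Omega>=\<Omega>]
      pderiv_dir_uminus[where \<Omega>=\<Omega>] test_fun_cnj field_simps)

lemma test_fun_diff: "\<phi> \<in> test_fun \<Omega> \<Longrightarrow> \<psi> \<in> test_fun \<Omega> \<Longrightarrow> (\<lambda>z. \<phi> z - \<psi> z) \<in> test_fun \<Omega>"
  using test_fun_add[of \<phi> \<Omega> "\<lambda>z. - \<psi> z"] test_fun_uminus[of \<psi>] by simp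

lemma pderiv_dir_diff:
  "\<phi> \<in> test_fun \<Omega> \<Longrightarrow> \<psi> \<in> test_fun \<Omega> \<Longrightarrow>
    pderiv_dir v (\<lambda>z. \<phi> z - \<psi> z) z = pderiv_dir v \<phi> z - pderiv_dir v \<psi> z"
  by (intro pderiv_dir_eq has_derivative_diff test_fun_has_derivative)

lemma Btest_cmult: "\<phi> \<in> Btest \<Longrightarrow> (\<lambda>z. W * \<phi> z) \<in> Btest"
  by (simp add: bc_components_in_iff test_fun_cmult test_fun_add test_fun_diff)

lemma bc_dbar_cmult: "\<phi> \<in> Btest \<Longrightarrow> bc_dbar (\<lambda>z. W * \<phi> z) z = W * bc_dbar \<phi> z"
  by (simp add: bicomplex_eq_iff bc_d_sel bc_components_in_iff pderiv_dir_cmult[where \<Omega>=\<Omega>]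
      pderiv_dir_add[where \<Omega>=\<Omega>] pderiv_dir_diff test_fun_cmult field_simps)

text \<open>Each condition on the right is a single real number, the real part of the scalar part of
  a bicomplex defect \<open>X\<close>. It suffices because test functions are stable under bicomplex
  constants and \<open>X\<close> is linear over them.\<close>

lemma weak_bc_dbar_iff_orthogonal:
  assumes W: "W \<in> BL2" and V: "V \<in> BL2"
  shows "weak_bc_dbar \<Omega> W V \<longleftrightarrow>
    (\<forall>\<Phi>\<in>Btest. (\<integral>z. bc_pair (W z) \<bullet> bc_pair (bc_d \<Phi> z) \<partial>M) + (\<integral>z. bc_pair (V z) \<bullet> bc_pair (\<Phi> z) \<partial>M) = 0)"
proof -
  define X where "X \<phi> = bc_integral \<Omega> (\<lambda>z. W z * bc_dbar \<phi> z) + bc_integral \<Omega> (\<lambda>z. V z * \<phi> z)" for \<phi>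
  have int: "integrable M (\<lambda>z. Sc (W z * bc_dbar \<phi> z))" "integrable M (\<lambda>z. Vec (W z * bc_dbar \<phi> z))"
      "integrable M (\<lambda>z. Sc (V z * \<phi> z))" "integrable M (\<lambda>z. Vec (V z * \<phi> z))" if "\<phi> \<in> Btest" for \<phi>
    using BL2_mult_integrable[OF W Btest_dbar[OF that]] BL2_mult_integrable[OF V Btest_BL2[OF that]] by auto
  have weak: "weak_bc_dbar \<Omega> W V \<longleftrightarrow> (\<forall>\<phi>\<in>Btest. X \<phi> = 0)"
    using BL2_imp_L1loc[OF V] by (simp add: weak_bc_dbar_def X_def eq_neg_iff_add_eq_0)
  have pair: "(\<integral>z. bc_pair (W z) \<bullet> bc_pair (bc_d \<Phi> z) \<partial>M) + (\<integral>z. bc_pair (V z) \<bullet> bc_pair (\<Phi> z) \<partial>M)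
      = Re (Sc (X (\<lambda>z. bc_dagger (\<Phi> z))))" if \<Phi>: "\<Phi> \<in> Btest" for \<Phi>
  proof -
    note \<Phi>' = Btest_dagger[OF \<Phi>]
    show ?thesis
      unfolding X_def inner_bc_pair bc_inner_dagger bc_d_dagger[OF \<Phi>] bicomplex_sel_simps(5) bc_integral_sel
      using int[OF \<Phi>'] by (simp only: integral_Re plus_complex.sel)
  qed
  have mult: "X (\<lambda>z. A * \<phi> z) = A * X \<phi>" if \<phi>: "\<phi> \<in> Btest" for A \<phi>
  proof -
    have "bc_integral \<Omega> (\<lambda>z. A * F z) = A * bc_integral \<Omega> F"
      if "integrable M (\<lambda>z. Sc (F z))" "integrable M (\<lambda>z. Vec (F z))" for F
      using that by (simp add: bicomplex_eq_iff)
    from this[of "\<lambda>z. W z * bc_dbar \<phi> z"] this[of "\<lambda>z. V z * \<phi> z"] int[OF \<phi>]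
    show ?thesis
      by (simp only: X_def bc_dbar_cmult[OF \<phi>] distrib_left mult.left_commute[of _ A])
  qed
  show ?thesis
    unfolding weak
  proof (intro iffI ballI)
    fix \<Phi> assume "\<forall>\<phi>\<in>Btest. X \<phi> = 0" and \<Phi>: "\<Phi> \<in> Btest"
    then show "(\<integral>z. bc_pair (W z) \<bullet> bc_pair (bc_d \<Phi> z) \<partial>M) + (\<integral>z. bc_pair (V z) \<bullet> bc_pair (\<Phi> z) \<partial>M) = 0"
      unfolding pair[OF \<Phi>] using Btest_dagger[OF \<Phi>] by simp
  next
    fix \<phi>
    assume *: "\<forall>\<Phi>\<in>Btest. (\<integral>z. bc_pair (W z) \<bullet> bc_pair (bc_d \<Phi> z) \<partial>M) + (\<integral>z. bc_pair (V z) \<bullet> bc_pair (\<Phi> z) \<partial>M) = 0"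
      and \<phi>: "\<phi> \<in> Btest"
    \<comment> \<open>Testing with the conjugate of the defect \<open>X \<phi>\<close> turns it into a sum of squares.\<close>
    define A where "A = bc_dagger (X \<phi>)"
    define \<Phi> where "\<Phi> z = bc_dagger (A * \<phi> z)" for z
    have \<Phi>: "\<Phi> \<in> Btest"
      unfolding \<Phi>_def by (intro Btest_dagger Btest_cmult \<phi>)
    \<comment> \<open>As \<open>bc_dagger\<close> is an involution, pairing with
      \<open>\<Phi>\<close> tests the defect with \<open>A * \<phi>\<close> itself.\<close>
    have "(\<lambda>z. bc_dagger (\<Phi> z)) = (\<lambda>z. A * \<phi> z)"
      by (simp add: \<Phi>_def fun_eq_iff bicomplex_eq_iff)
    then have "Re (Sc (A * X \<phi>)) = 0"
      using * \<Phi> pair[OF \<Phi>] mult[OF \<phi>] by simp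
    then have "(cmod (Sc (X \<phi>)))\<^sup>2 + (cmod (Vec (X \<phi>)))\<^sup>2 = 0"
      unfolding A_def Sc_mult_dagger .
    then show "X \<phi> = 0"
      by (simp add: bicomplex_eq_iff sum_power2_eq_zero_iff)
  qed
qed

section \<open>Limits of test functions with their weak partial derivatives\<close>

lemma weak_pderiv_dir_add:
  assumes "f \<in> l2 M" "g \<in> l2 M" "f' \<in> l2 M" "g' \<in> l2 M"
    and "weak_pderiv_dir v \<Omega> f f'" "weak_pderiv_dir v \<Omega> g g'"
  shows "weak_pderiv_dir v \<Omega> (\<lambda>z. f z + g z) (\<lambda>z. f' z + g' z)"
  using assms
  by (simp add: weak_pderiv_dir_def l2_imp_L1loc l2_add distrib_right l2_mult_integrable
      test_fun_l2 test_fun_pderiv_dir)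

lemma weak_pderiv_dir_cmult:
  assumes "f' \<in> l2 M" and "weak_pderiv_dir v \<Omega> f f'"
  shows "weak_pderiv_dir v \<Omega> (\<lambda>z. c * f z) (\<lambda>z. c * f' z)"
  using assms by (simp add: weak_pderiv_dir_def l2_imp_L1loc l2_cmult mult.assoc)

lemma W012_iff:
  "f \<in> W012_fun \<Omega> \<longleftrightarrow> (\<exists>fx fy \<phi>. weak_pderiv_dir 1 \<Omega> f fx \<and> weak_pderiv_dir \<i> \<Omega> f fy \<and>
     (\<forall>n. \<phi> n \<in> test_fun \<Omega>) \<and> l2_tendsto M \<phi> f \<and>
     l2_tendsto M (\<lambda>n. pderiv_dir 1 (\<phi> n)) fx \<and> l2_tendsto M (\<lambda>n. pderiv_dir \<i> (\<phi> n)) fy)"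
proof -
  have "f \<in> W012_fun \<Omega> \<longleftrightarrow> f \<in> l2 M \<and> (\<exists>fx fy \<phi>. fx \<in> l2 M \<and> fy \<in> l2 M \<and>
      weak_pderiv_dir 1 \<Omega> f fx \<and> weak_pderiv_dir \<i> \<Omega> f fy \<and> (\<forall>n. \<phi> n \<in> test_fun \<Omega>) \<and>
      (\<lambda>n. l2_norm M (\<lambda>z. \<phi> n z - f z)) \<longlonglongrightarrow> 0 \<and>
      (\<lambda>n. l2_norm M (\<lambda>z. pderiv_dir 1 (\<phi> n) z - fx z)) \<longlonglongrightarrow> 0 \<and>
      (\<lambda>n. l2_norm M (\<lambda>z. pderiv_dir \<i> (\<phi> n) z - fy z)) \<longlonglongrightarrow> 0)"
    unfolding W012_fun_def L2_fun_eq L2_norm_fun_eq by blast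
  also have "\<dots> \<longleftrightarrow> (\<exists>fx fy \<phi>. weak_pderiv_dir 1 \<Omega> f fx \<and> weak_pderiv_dir \<i> \<Omega> f fy \<and>
     (\<forall>n. \<phi> n \<in> test_fun \<Omega>) \<and> l2_tendsto M \<phi> f \<and>
     l2_tendsto M (\<lambda>n. pderiv_dir 1 (\<phi> n)) fx \<and> l2_tendsto M (\<lambda>n. pderiv_dir \<i> (\<phi> n)) fy)"
    unfolding l2_tendsto_def using test_fun_l2 test_fun_pderiv_dir by meson
  finally show ?thesis .
qed

lemma W012_l2: "f \<in> W012_fun \<Omega> \<Longrightarrow> f \<in> l2 M"
  by (simp add: W012_fun_def L2_fun_eq)

lemma BW012_BL2: "\<Phi> \<in> BW012 \<Longrightarrow> \<Phi> \<in> BL2"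
  by (simp add: bc_components_in_iff W012_l2 L2_fun_eq)

lemma test_fun_W012:
  assumes \<phi>: "\<phi> \<in> test_fun \<Omega>"
  shows "\<phi> \<in> W012_fun \<Omega>"
proof -
  have "l2_tendsto M (\<lambda>_. f) f" if "f \<in> l2 M" for f :: "complex \<Rightarrow> complex"
    using that by (simp add: l2_tendsto_def l2_norm_def)
  then show ?thesis
    unfolding W012_iff using \<phi>
    by (intro exI[of _ "pderiv_dir 1 \<phi>"] exI[of _ "pderiv_dir \<i> \<phi>"] exI[of _ "\<lambda>_. \<phi>"])
       (simp add: test_fun_weak_pderiv_dir sets_\<Omega> test_fun_l2 test_fun_pderiv_dir)
qed

lemma W012_add:
  assumes "f \<in> W012_fun \<Omega>" "g \<in> W012_fun \<Omega>"
  shows "(\<lambda>z. f z + g z) \<in> W012_fun \<Omega>"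
proof -
  obtain fx fy \<phi> where f: "weak_pderiv_dir 1 \<Omega> f fx" "weak_pderiv_dir \<i> \<Omega> f fy" "\<And>n. \<phi> n \<in> test_fun \<Omega>"
    "l2_tendsto M \<phi> f" "l2_tendsto M (\<lambda>n. pderiv_dir 1 (\<phi> n)) fx" "l2_tendsto M (\<lambda>n. pderiv_dir \<i> (\<phi> n)) fy"
    using assms(1) unfolding W012_iff by blast
  obtain gx gy \<psi> where g: "weak_pderiv_dir 1 \<Omega> g gx" "weak_pderiv_dir \<i> \<Omega> g gy" "\<And>n. \<psi> n \<in> test_fun \<Omega>"
    "l2_tendsto M \<psi> g" "l2_tendsto M (\<lambda>n. pderiv_dir 1 (\<psi> n)) gx" "l2_tendsto M (\<lambda>n. pderiv_dir \<i> (\<psi> n)) gy"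
    using assms(2) unfolding W012_iff by blast
  have l2: "f \<in> l2 M" "g \<in> l2 M" "fx \<in> l2 M" "fy \<in> l2 M" "gx \<in> l2 M" "gy \<in> l2 M"
    using f g by (auto simp: l2_tendsto_def)
  have d: "pderiv_dir v (\<lambda>z. \<phi> n z + \<psi> n z) = (\<lambda>z. pderiv_dir v (\<phi> n) z + pderiv_dir v (\<psi> n) z)" for n v
    using f(3) g(3) by (intro ext pderiv_dir_add)
  show ?thesis
    unfolding W012_iff
    by (intro exI[of _ "\<lambda>z. fx z + gx z"] exI[of _ "\<lambda>z. fy z + gy z"] exI[of _ "\<lambda>n z. \<phi> n z + \<psi> n z"])
       (simp add: weak_pderiv_dir_add l2 f g test_fun_add d l2_tendsto_add)
qed

lemma W012_cmult:
  assumes "f \<in> W012_fun \<Omega>"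
  shows "(\<lambda>z. c * f z) \<in> W012_fun \<Omega>"
proof -
  obtain fx fy \<phi> where f: "weak_pderiv_dir 1 \<Omega> f fx" "weak_pderiv_dir \<i> \<Omega> f fy" "\<And>n. \<phi> n \<in> test_fun \<Omega>"
    "l2_tendsto M \<phi> f" "l2_tendsto M (\<lambda>n. pderiv_dir 1 (\<phi> n)) fx" "l2_tendsto M (\<lambda>n. pderiv_dir \<i> (\<phi> n)) fy"
    using assms(1) unfolding W012_iff by blast
  have l2: "fx \<in> l2 M" "fy \<in> l2 M"
    using f by (auto simp: l2_tendsto_def)
  have d: "pderiv_dir v (\<lambda>z. c * \<phi> n z) = (\<lambda>z. c * pderiv_dir v (\<phi> n) z)" for n v
    using f(3) by (intro ext pderiv_dir_cmult)
  show ?thesis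
    unfolding W012_iff
    by (intro exI[of _ "\<lambda>z. c * fx z"] exI[of _ "\<lambda>z. c * fy z"] exI[of _ "\<lambda>n z. c * \<phi> n z"])
       (simp add: weak_pderiv_dir_cmult l2 f test_fun_cmult d l2_tendsto_cmult)
qed

lemma BW012_zero: "(\<lambda>z. 0) \<in> BW012"
  by (simp add: bc_components_in_iff test_fun_W012)

lemma BW012_add: "\<Phi> \<in> BW012 \<Longrightarrow> \<Psi> \<in> BW012 \<Longrightarrow> (\<lambda>z. \<Phi> z + \<Psi> z) \<in> BW012"
  by (simp add: bc_components_in_iff W012_add)

lemma BW012_cmult: "\<Phi> \<in> BW012 \<Longrightarrow> (\<lambda>z. bc_of_complex c * \<Phi> z) \<in> BW012"
  by (simp add: bc_components_in_iff W012_cmult)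

section \<open>Weak bicomplex derivatives\<close>

text \<open>Integration by parts holds for each component of \<open>\<Phi>\<close> in each of the
  two directions. Testing it with both components of \<open>\<phi>\<close> yields four terms for the
  scalar part and four for the vector part of the bicomplex identity.\<close>

lemma weak_bc_d_of_partials:
  assumes \<Phi>: "\<Phi> \<in> BL2"
    and l2: "fx \<in> l2 M" "fy \<in> l2 M" "gx \<in> l2 M" "gy \<in> l2 M"
    and f: "weak_pderiv_dir 1 \<Omega> (\<lambda>z. Sc (\<Phi> z)) fx" "weak_pderiv_dir \<i> \<Omega> (\<lambda>z. Sc (\<Phi> z)) fy"
    and g: "weak_pderiv_dir 1 \<Omega> (\<lambda>z. Vec (\<Phi> z)) gx" "weak_pderiv_dir \<i> \<Omega> (\<lambda>z. Vec (\<Phi> z)) gy"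
  shows "weak_bc_d \<Omega> \<Phi> (\<lambda>z. Bicomplex ((fx z + gy z) / 2) ((gx z - fy z) / 2))"
  unfolding weak_bc_d_def
proof (intro conjI ballI)
  show "(\<lambda>z. Bicomplex ((fx z + gy z) / 2) ((gx z - fy z) / 2)) \<in> bc_components_in (L1loc_fun \<Omega>)"
    by (intro BL2_imp_L1loc) (simp add: bc_components_in_iff L2_fun_eq l2 l2_half l2_add l2_diff)
next
  fix \<phi> assume \<phi>: "\<phi> \<in> Btest"
  define p where "p z = Sc (\<phi> z)" for z
  define q where "q z = Vec (\<phi> z)" for z
  define F where "F z = Sc (\<Phi> z)" for z
  define G where "G z = Vec (\<Phi> z)" for z
  have pq: "p \<in> test_fun \<Omega>" "q \<in> test_fun \<Omega>"
    using \<phi> by (simp_all add: bc_components_in_iff p_def[abs_def] q_def[abs_def])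
  have FG: "F \<in> l2 M" "G \<in> l2 M"
    using BL2_sel[OF \<Phi>] by (simp_all add: F_def[abs_def] G_def[abs_def])
  have int: "integrable M (\<lambda>z. u z * r z)" "integrable M (\<lambda>z. u z * pderiv_dir v r z)"
    if "u \<in> l2 M" "r \<in> test_fun \<Omega>" for u r v
    using that by (auto intro!: l2_mult_integrable test_fun_l2 test_fun_pderiv_dir)
  have parts: "(\<integral>z. F z * pderiv_dir 1 r z \<partial>M) = - (\<integral>z. fx z * r z \<partial>M)"
      "(\<integral>z. F z * pderiv_dir \<i> r z \<partial>M) = - (\<integral>z. fy z * r z \<partial>M)"
      "(\<integral>z. G z * pderiv_dir 1 r z \<partial>M) = - (\<integral>z. gx z * r z \<partial>M)"
      "(\<integral>z. G z * pderiv_dir \<i> r z \<partial>M) = - (\<integral>z. gy z * r z \<partial>M)" if "r \<in> test_fun \<Omega>" for r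
    using f g that by (simp_all add: weak_pderiv_dir_def F_def G_def)
  have Sc: "(\<integral>z. Sc (\<Phi> z * bc_d \<phi> z) \<partial>M) = - (\<integral>z. (fx z + gy z) / 2 * p z - (gx z - fy z) / 2 * q z \<partial>M)"
  proof -
    have "(\<integral>z. Sc (\<Phi> z * bc_d \<phi> z) \<partial>M)
      = (\<integral>z. ((F z * pderiv_dir 1 p z + F z * pderiv_dir \<i> q z) - (G z * pderiv_dir 1 q z - G z * pderiv_dir \<i> p z)) / 2 \<partial>M)"
      by (rule Bochner_Integration.integral_cong)
         (simp_all add: bc_d_sel p_def[abs_def] q_def[abs_def] F_def G_def field_simps)
    also have "\<dots> = - (\<integral>z. ((fx z * p z + gy z * p z) - (gx z * q z - fy z * q z)) / 2 \<partial>M)"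
      by (simp add: int pq FG l2 parts field_simps)
    also have "(\<integral>z. ((fx z * p z + gy z * p z) - (gx z * q z - fy z * q z)) / 2 \<partial>M)
      = (\<integral>z. (fx z + gy z) / 2 * p z - (gx z - fy z) / 2 * q z \<partial>M)"
      by (rule Bochner_Integration.integral_cong) (simp_all add: field_simps)
    finally show ?thesis .
  qed
  have Vec: "(\<integral>z. Vec (\<Phi> z * bc_d \<phi> z) \<partial>M) = - (\<integral>z. (fx z + gy z) / 2 * q z + (gx z - fy z) / 2 * p z \<partial>M)"
  proof -
    have "(\<integral>z. Vec (\<Phi> z * bc_d \<phi> z) \<partial>M)
      = (\<integral>z. ((F z * pderiv_dir 1 q z - F z * pderiv_dir \<i> p z) + (G z * pderiv_dir 1 p z + G z * pderiv_dir \<i> q z)) / 2 \<partial>M)"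
      by (rule Bochner_Integration.integral_cong)
         (simp_all add: bc_d_sel p_def[abs_def] q_def[abs_def] F_def G_def field_simps)
    also have "\<dots> = - (\<integral>z. ((fx z * q z + gy z * q z) + (gx z * p z - fy z * p z)) / 2 \<partial>M)"
      by (simp add: int pq FG l2 parts field_simps)
    also have "(\<integral>z. ((fx z * q z + gy z * q z) + (gx z * p z - fy z * p z)) / 2 \<partial>M)
      = (\<integral>z. (fx z + gy z) / 2 * q z + (gx z - fy z) / 2 * p z \<partial>M)"
      by (rule Bochner_Integration.integral_cong) (simp_all add: field_simps)
    finally show ?thesis .
  qed
  show "bc_integral \<Omega> (\<lambda>z. \<Phi> z * bc_d \<phi> z)
      = - bc_integral \<Omega> (\<lambda>z. Bicomplex ((fx z + gy z) / 2) ((gx z - fy z) / 2) * \<phi> z)"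
    unfolding bicomplex_eq_iff bicomplex_sel_simps(9,10) bc_integral_sel Sc Vec
    by (simp add: p_def q_def)
qed

lemma test_weak_bc_d:
  assumes \<Phi>: "\<Phi> \<in> Btest"
  shows "weak_bc_d \<Omega> \<Phi> (bc_d \<Phi>)"
proof -
  have t: "(\<lambda>z. Sc (\<Phi> z)) \<in> test_fun \<Omega>" "(\<lambda>z. Vec (\<Phi> z)) \<in> test_fun \<Omega>"
    using \<Phi> by (simp_all add: bc_components_in_iff)
  have eq: "bc_d \<Phi> = (\<lambda>z. Bicomplex
      ((pderiv_dir 1 (\<lambda>z. Sc (\<Phi> z)) z + pderiv_dir \<i> (\<lambda>z. Vec (\<Phi> z)) z) / 2)
      ((pderiv_dir 1 (\<lambda>z. Vec (\<Phi> z)) z - pderiv_dir \<i> (\<lambda>z. Sc (\<Phi> z)) z) / 2))"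
    by (simp add: fun_eq_iff bicomplex_eq_iff bc_d_sel)
  show ?thesis
    unfolding eq
    by (intro weak_bc_d_of_partials Btest_BL2 \<Phi> test_fun_l2 test_fun_pderiv_dir
        test_fun_weak_pderiv_dir sets_\<Omega> t)
qed

text \<open>Complex-valued test functions, embedded by \<open>bc_of_complex\<close>, separate the
  components; the fundamental lemma then applies to each component of the difference.\<close>

lemma weak_bc_d_unique:
  assumes D: "D \<in> BL2" "weak_bc_d \<Omega> \<Phi> D" and E: "E \<in> BL2" "weak_bc_d \<Omega> \<Phi> E"
  shows "AE z in M. D z = E z"
proof -
  have eq: "bc_integral \<Omega> (\<lambda>z. D z * \<phi> z) = bc_integral \<Omega> (\<lambda>z. E z * \<phi> z)" if "\<phi> \<in> Btest" for \<phi>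
    using D E that unfolding weak_bc_d_def by (metis neg_equal_iff_equal)
  have eq1: "(\<integral>z. Sc (D z) * p z \<partial>M) = (\<integral>z. Sc (E z) * p z \<partial>M)"
      "(\<integral>z. Vec (D z) * p z \<partial>M) = (\<integral>z. Vec (E z) * p z \<partial>M)" if "p \<in> test_fun \<Omega>" for p
    using eq[of "\<lambda>z. bc_of_complex (p z)"] that
    by (simp_all add: bicomplex_eq_iff bc_components_in_iff)
  have "AE z in M. f z - g z = 0"
    if "f \<in> l2 M" "g \<in> l2 M" "\<And>p. p \<in> test_fun \<Omega> \<Longrightarrow> (\<integral>z. f z * p z \<partial>M) = (\<integral>z. g z * p z \<partial>M)" for f g
  proof (rule test_fun_AE_eq_0[OF open_\<Omega>])
    show "integrable M (\<lambda>z. f z - g z)"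
      by (intro l2_imp_integrable finite_measure_M l2_diff that)
    show "(\<integral>z. (f z - g z) * p z \<partial>M) = 0" if "p \<in> test_fun \<Omega>" for p
      using \<open>f \<in> l2 M\<close> \<open>g \<in> l2 M\<close> that \<open>\<And>p. p \<in> test_fun \<Omega> \<Longrightarrow> (\<integral>z. f z * p z \<partial>M) = (\<integral>z. g z * p z \<partial>M)\<close>
      by (simp add: left_diff_distrib l2_mult_integrable test_fun_l2)
  qed
  note null = this
  have "AE z in M. Sc (D z) - Sc (E z) = 0"
    by (rule null[OF BL2_sel(1)[OF D(1)] BL2_sel(1)[OF E(1)]]) (rule eq1(1))
  moreover have "AE z in M. Vec (D z) - Vec (E z) = 0"
    by (rule null[OF BL2_sel(2)[OF D(1)] BL2_sel(2)[OF E(1)]]) (rule eq1(2))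
  ultimately show ?thesis
    by eventually_elim (simp add: bicomplex_eq_iff)
qed

lemma l2_tendsto_cong_AE:
  assumes "l2_tendsto M G H" and H': "H' \<in> l2 M" and ae: "AE z in M. H z = H' z"
  shows "l2_tendsto M G H'"
proof -
  have GH: "G n \<in> l2 M" "H \<in> l2 M" for n using assms(1) by (auto simp: l2_tendsto_def)
  note [measurable] = l2_measurable[OF GH(1)] l2_measurable[OF GH(2)] l2_measurable[OF H']
  have "l2_norm M (\<lambda>z. G n z - H z) = l2_norm M (\<lambda>z. G n z - H' z)" for n
    unfolding l2_norm_def
    by (intro arg_cong[where f=sqrt] integral_cong_AE) (use ae in \<open>auto elim!: eventually_mono\<close>)
  with assms show ?thesis
    by (simp add: l2_tendsto_def)
qed

text \<open>\<open>D\<close> is any weak derivative, whereas \<open>W012_fun\<close> supplies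
  convergence to particular weak partials. Uniqueness bridges the gap: the combination
  \<open>E\<close> of these partials agrees with \<open>D\<close> almost everywhere.\<close>

lemma BW012_approx:
  assumes \<Phi>: "\<Phi> \<in> BW012" and D: "D \<in> BL2" "weak_bc_d \<Omega> \<Phi> D"
  obtains \<Psi> where "\<And>n. \<Psi> n \<in> Btest"
    and "l2_tendsto M (\<lambda>n z. bc_pair (\<Psi> n z)) (\<lambda>z. bc_pair (\<Phi> z))"
    and "l2_tendsto M (\<lambda>n z. bc_pair (bc_d (\<Psi> n) z)) (\<lambda>z. bc_pair (D z))"
proof -
  have W: "(\<lambda>z. Sc (\<Phi> z)) \<in> W012_fun \<Omega>" "(\<lambda>z. Vec (\<Phi> z)) \<in> W012_fun \<Omega>"
    using \<Phi> by (simp_all add: bc_components_in_iff)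
  obtain fx fy \<phi> where f: "weak_pderiv_dir 1 \<Omega> (\<lambda>z. Sc (\<Phi> z)) fx" "weak_pderiv_dir \<i> \<Omega> (\<lambda>z. Sc (\<Phi> z)) fy"
    "\<And>n. \<phi> n \<in> test_fun \<Omega>" "l2_tendsto M \<phi> (\<lambda>z. Sc (\<Phi> z))"
    "l2_tendsto M (\<lambda>n. pderiv_dir 1 (\<phi> n)) fx" "l2_tendsto M (\<lambda>n. pderiv_dir \<i> (\<phi> n)) fy"
    using W(1) unfolding W012_iff by blast
  obtain gx gy \<psi> where g: "weak_pderiv_dir 1 \<Omega> (\<lambda>z. Vec (\<Phi> z)) gx" "weak_pderiv_dir \<i> \<Omega> (\<lambda>z. Vec (\<Phi> z)) gy"
    "\<And>n. \<psi> n \<in> test_fun \<Omega>" "l2_tendsto M \<psi> (\<lambda>z. Vec (\<Phi> z))"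
    "l2_tendsto M (\<lambda>n. pderiv_dir 1 (\<psi> n)) gx" "l2_tendsto M (\<lambda>n. pderiv_dir \<i> (\<psi> n)) gy"
    using W(2) unfolding W012_iff by blast
  have l2: "fx \<in> l2 M" "fy \<in> l2 M" "gx \<in> l2 M" "gy \<in> l2 M"
    using f g by (auto simp: l2_tendsto_def)
  define E where "E z = Bicomplex ((fx z + gy z) / 2) ((gx z - fy z) / 2)" for z
  define \<Psi> where "\<Psi> n z = Bicomplex (\<phi> n z) (\<psi> n z)" for n z
  have E: "E \<in> BL2"
    by (simp add: E_def[abs_def] bc_components_in_iff L2_fun_eq l2 l2_half l2_add l2_diff)
  have "weak_bc_d \<Omega> \<Phi> E"
    unfolding E_def[abs_def] by (intro weak_bc_d_of_partials BW012_BL2 \<Phi> l2 f g)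
  then have ED: "AE z in M. bc_pair (E z) = bc_pair (D z)"
    using weak_bc_d_unique[OF E _ D] by (auto elim!: eventually_mono)
  have "l2_tendsto M (\<lambda>n z. ((1/2) * (pderiv_dir 1 (\<phi> n) z + pderiv_dir \<i> (\<psi> n) z),
        (1/2) * (pderiv_dir 1 (\<psi> n) z + (-1) * pderiv_dir \<i> (\<phi> n) z)))
      (\<lambda>z. ((1/2) * (fx z + gy z), (1/2) * (gx z + (-1) * fy z)))"
    by (intro l2_tendsto_Pair l2_tendsto_cmult l2_tendsto_add f g)
  then have "l2_tendsto M (\<lambda>n z. bc_pair (bc_d (\<Psi> n) z)) (\<lambda>z. bc_pair (E z))"
    by (simp add: bc_pair_def bc_d_sel \<Psi>_def E_def)
  then have 1: "l2_tendsto M (\<lambda>n z. bc_pair (bc_d (\<Psi> n) z)) (\<lambda>z. bc_pair (D z))"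
    by (rule l2_tendsto_cong_AE) (use D ED in \<open>simp_all add: BL2_iff\<close>)
  have 2: "l2_tendsto M (\<lambda>n z. bc_pair (\<Psi> n z)) (\<lambda>z. bc_pair (\<Phi> z))"
    using l2_tendsto_Pair[OF f(4) g(4)] by (simp add: bc_pair_def \<Psi>_def)
  have "\<Psi> n \<in> Btest" for n
    using f g by (simp add: \<Psi>_def[abs_def] bc_components_in_iff)
  from this 2 1 show ?thesis by (rule that)
qed

lemma weak_bc_d_add:
  assumes "\<Phi> \<in> BL2" "\<Psi> \<in> BL2" "D \<in> BL2" "E \<in> BL2" and "weak_bc_d \<Omega> \<Phi> D" "weak_bc_d \<Omega> \<Psi> E"
  shows "weak_bc_d \<Omega> (\<lambda>z. \<Phi> z + \<Psi> z) (\<lambda>z. D z + E z)"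
proof -
  have add: "bc_integral \<Omega> (\<lambda>z. (F z + G z) * H z) = bc_integral \<Omega> (\<lambda>z. F z * H z) + bc_integral \<Omega> (\<lambda>z. G z * H z)"
    if "F \<in> BL2" "G \<in> BL2" "H \<in> BL2" for F G H
  proof -
    have "bc_integral \<Omega> (\<lambda>z. F z * H z + G z * H z) = bc_integral \<Omega> (\<lambda>z. F z * H z) + bc_integral \<Omega> (\<lambda>z. G z * H z)"
      using BL2_mult_integrable[OF that(1,3)] BL2_mult_integrable[OF that(2,3)]
      unfolding bicomplex_eq_iff bicomplex_sel_simps(5,6) bc_integral_sel by simp
    then show ?thesis by (simp add: distrib_right)
  qed
  show ?thesis
    using assms by (simp add: weak_bc_d_def add Btest_d Btest_BL2 BL2_imp_L1loc BL2_add)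
qed

lemma weak_bc_d_cmult:
  assumes "D \<in> BL2" and "weak_bc_d \<Omega> \<Phi> D"
  shows "weak_bc_d \<Omega> (\<lambda>z. bc_of_complex c * \<Phi> z) (\<lambda>z. bc_of_complex c * D z)"
proof -
  have "bc_integral \<Omega> (\<lambda>z. bc_of_complex c * F z) = bc_of_complex c * bc_integral \<Omega> F" for F
    by (simp add: bicomplex_eq_iff)
  with assms show ?thesis
    by (simp add: weak_bc_d_def mult.assoc BL2_imp_L1loc BL2_cmult)
qed

section \<open>The Hermitian inner product and closures of subspaces\<close>

lemma bc_L2_inner_integrable: "F \<in> BL2 \<Longrightarrow> G \<in> BL2 \<Longrightarrow> integrable M (\<lambda>z. bc_inner (F z) (G z))"
  by (rule BL2_mult_integrable)

lemma Re_bc_L2_inner: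
  assumes "F \<in> BL2" "G \<in> BL2"
  shows "Re (bc_L2_inner \<Omega> F G) = (\<integral>z. bc_pair (F z) \<bullet> bc_pair (G z) \<partial>M)"
  unfolding bc_L2_inner_def inner_bc_pair by (rule integral_Re[symmetric, OF bc_L2_inner_integrable[OF assms]])

text \<open>The product is conjugate-linear in its second argument, so its real part at
  \<open>\<i>\<close> times \<open>G\<close> is its imaginary part at \<open>G\<close>.\<close>

lemma bc_L2_inner_eq_0I:
  assumes "F \<in> BL2" "G \<in> BL2"
    and "(\<integral>z. bc_pair (F z) \<bullet> bc_pair (G z) \<partial>M) = 0"
    and "(\<integral>z. bc_pair (F z) \<bullet> bc_pair (bc_of_complex \<i> * G z) \<partial>M) = 0"
  shows "bc_L2_inner \<Omega> F G = 0"
proof -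
  have "bc_L2_inner \<Omega> F (\<lambda>z. bc_of_complex \<i> * G z) = - \<i> * bc_L2_inner \<Omega> F G"
    unfolding bc_L2_inner_def by (simp add: bc_inner_def algebra_simps flip: integral_mult_right_zero)
  with assms show ?thesis
    by (simp add: Re_bc_L2_inner[symmetric] BL2_cmult complex_eq_iff)
qed

lemma bc_L2_norm_triangle:
  "F \<in> BL2 \<Longrightarrow> G \<in> BL2 \<Longrightarrow> bc_L2_norm \<Omega> (\<lambda>z. F z + G z) \<le> bc_L2_norm \<Omega> F + bc_L2_norm \<Omega> G"
  unfolding bc_L2_norm_eq bc_pair_simps BL2_iff by (rule l2_norm_triangle)

lemma bc_L2_norm_cmult: "bc_L2_norm \<Omega> (\<lambda>z. bc_of_complex c * F z) = cmod c * bc_L2_norm \<Omega> F"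
  unfolding bc_L2_norm_eq
  by (rule l2_norm_cmult)
     (simp_all add: bc_pair_def norm_Pair norm_mult power_mult_distrib real_sqrt_mult flip: distrib_left)

lemma bc_L2_subspace_closure:
  assumes S: "bc_L2_subspace \<Omega> S"
  shows "bc_L2_subspace \<Omega> (bc_L2_closure \<Omega> S)"
  unfolding bc_L2_subspace_def
proof (intro conjI ballI allI)
  have SL: "S \<subseteq> BL2" and S0: "(\<lambda>z. 0) \<in> S"
    and Sadd: "\<And>F G. F \<in> S \<Longrightarrow> G \<in> S \<Longrightarrow> (\<lambda>z. F z + G z) \<in> S"
    and Scmult: "\<And>c F. F \<in> S \<Longrightarrow> (\<lambda>z. bc_of_complex c * F z) \<in> S"
    using S by (auto simp: bc_L2_subspace_def)
  show "bc_L2_closure \<Omega> S \<subseteq> BL2"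
    by (auto simp: bc_L2_closure_def)
  have "bc_L2_norm \<Omega> (\<lambda>z. 0) = 0"
    by (simp add: bc_L2_norm_def bc_L2_inner_def bc_inner_def)
  then show "(\<lambda>z. 0) \<in> bc_L2_closure \<Omega> S"
    using S0 by (auto simp: bc_L2_closure_def BL2_zero intro!: bexI[of _ "\<lambda>z. 0"])
  show "(\<lambda>z. F z + G z) \<in> bc_L2_closure \<Omega> S"
    if F: "F \<in> bc_L2_closure \<Omega> S" and G: "G \<in> bc_L2_closure \<Omega> S" for F G
    unfolding bc_L2_closure_def mem_Collect_eq
  proof (intro conjI allI impI)
    have FG: "F \<in> BL2" "G \<in> BL2" using F G by (auto simp: bc_L2_closure_def)
    then show "(\<lambda>z. F z + G z) \<in> BL2" by (rule BL2_add)
    fix e :: real assume "0 < e"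
    then have e: "0 < e / 2" by simp
    obtain F' where F': "F' \<in> S" "bc_L2_norm \<Omega> (\<lambda>z. F z - F' z) < e / 2"
      using F e unfolding bc_L2_closure_def by blast
    obtain G' where G': "G' \<in> S" "bc_L2_norm \<Omega> (\<lambda>z. G z - G' z) < e / 2"
      using G e unfolding bc_L2_closure_def by blast
    have "bc_L2_norm \<Omega> (\<lambda>z. (F z - F' z) + (G z - G' z)) < e"
      using bc_L2_norm_triangle[OF BL2_diff[OF FG(1)] BL2_diff[OF FG(2)], of F' G'] SL F' G'
      by (auto simp: subset_iff)
    then show "\<exists>H\<in>S. bc_L2_norm \<Omega> (\<lambda>z. F z + G z - H z) < e"
      using Sadd[OF F'(1) G'(1)] by (auto simp: add_diff_add intro!: bexI[of _ "\<lambda>z. F' z + G' z"])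
  qed
  show "(\<lambda>z. bc_of_complex c * F z) \<in> bc_L2_closure \<Omega> S"
    if F: "F \<in> bc_L2_closure \<Omega> S" for c F
    unfolding bc_L2_closure_def mem_Collect_eq
  proof (intro conjI allI impI)
    show "(\<lambda>z. bc_of_complex c * F z) \<in> BL2"
      using F by (auto simp: bc_L2_closure_def intro: BL2_cmult)
    fix e :: real assume "0 < e"
    \<comment> \<open>The summand 1 keeps the denominator positive when
      \<open>c = 0\<close>.\<close>
    have c: "0 < cmod c + 1" by (simp add: add_nonneg_pos)
    with \<open>0 < e\<close> have "0 < e / (cmod c + 1)" by simp
    then obtain F' where F': "F' \<in> S" "bc_L2_norm \<Omega> (\<lambda>z. F z - F' z) < e / (cmod c + 1)"
      using F unfolding bc_L2_closure_def by blast
    have "cmod c * bc_L2_norm \<Omega> (\<lambda>z. F z - F' z) \<le> (cmod c + 1) * bc_L2_norm \<Omega> (\<lambda>z. F z - F' z)"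
      by (intro mult_right_mono) (simp_all add: bc_L2_norm_eq)
    also have "\<dots> < e"
      using F'(2) unfolding pos_less_divide_eq[OF c] by (simp add: mult.commute)
    finally have "bc_L2_norm \<Omega> (\<lambda>z. bc_of_complex c * F z - bc_of_complex c * F' z) < e"
      using bc_L2_norm_cmult[of c "\<lambda>z. F z - F' z"] by (simp add: right_diff_distrib)
    then show "\<exists>H\<in>S. bc_L2_norm \<Omega> (\<lambda>z. bc_of_complex c * F z - H z) < e"
      using Scmult[OF F'(1), of c] by (intro bexI[of _ "\<lambda>z. bc_of_complex c * F' z"])
  qed
qed

end

subsection \<open>The Vekua operator and its adjoint\<close>

locale vekua_coefficients = bounded_open_set +
  fixes a b :: "complex \<Rightarrow> bicomplex"
  assumes a: "a \<in> BLinf" and b: "b \<in> BLinf"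
begin

abbreviation "R \<equiv> vekua_adjoint_range \<Omega> a b"
abbreviation "vekua_rhs W \<equiv> \<lambda>z. a z * W z + b z * bc_bar (W z)"

lemma vekua_rhs_BL2: "W \<in> BL2 \<Longrightarrow> vekua_rhs W \<in> BL2"
  by (intro BL2_add BL2_mult_Linf BL2_bar a b)

lemma vekua_adjoint_rangeI:
  assumes "\<Phi> \<in> BW012" "D \<in> BL2" "weak_bc_d \<Omega> \<Phi> D"
    and "\<And>z. G z = D z + bc_dagger (a z) * \<Phi> z + bc_star (b z) * bc_bar (\<Phi> z)"
  shows "G \<in> R"
  using assms unfolding vekua_adjoint_range_def by (auto simp: fun_eq_iff)

lemma vekua_adjoint_rangeE:
  assumes "G \<in> R"
  obtains \<Phi> D where "\<Phi> \<in> BW012" "D \<in> BL2" "weak_bc_d \<Omega> \<Phi> D"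
    and "G = (\<lambda>z. D z + bc_dagger (a z) * \<Phi> z + bc_star (b z) * bc_bar (\<Phi> z))"
  using assms unfolding vekua_adjoint_range_def by blast

lemma vekua_adjoint_range_subset: "R \<subseteq> BL2"
proof
  fix G assume "G \<in> R"
  then obtain \<Phi> D where D: "D \<in> BL2" and \<Phi>: "\<Phi> \<in> BW012"
    and G: "G = (\<lambda>z. D z + bc_dagger (a z) * \<Phi> z + bc_star (b z) * bc_bar (\<Phi> z))"
    by (rule vekua_adjoint_rangeE)
  show "G \<in> BL2"
    unfolding G
    by (intro BL2_add BL2_mult_Linf BLinf_dagger BLinf_star a b BL2_bar BW012_BL2[OF \<Phi>] D)
qed

lemma bc_L2_subspace_vekua_adjoint_range: "bc_L2_subspace \<Omega> R"
  unfolding bc_L2_subspace_def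
proof (intro conjI ballI allI vekua_adjoint_range_subset)
  have "weak_bc_d \<Omega> (\<lambda>z. 0) (\<lambda>z. 0)"
    by (simp add: weak_bc_d_def BL2_imp_L1loc BL2_zero bicomplex_eq_iff)
  then show "(\<lambda>z. 0) \<in> R"
    by (intro vekua_adjoint_rangeI[of "\<lambda>z. 0" "\<lambda>z. 0"] BW012_zero BL2_zero)
       (simp_all add: bicomplex_eq_iff)
next
  fix G H assume "G \<in> R" "H \<in> R"
  obtain \<Phi> D where G: "\<Phi> \<in> BW012" "D \<in> BL2" "weak_bc_d \<Omega> \<Phi> D"
    "G = (\<lambda>z. D z + bc_dagger (a z) * \<Phi> z + bc_star (b z) * bc_bar (\<Phi> z))"
    using \<open>G \<in> R\<close> by (rule vekua_adjoint_rangeE)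
  obtain \<Psi> E where H: "\<Psi> \<in> BW012" "E \<in> BL2" "weak_bc_d \<Omega> \<Psi> E"
    "H = (\<lambda>z. E z + bc_dagger (a z) * \<Psi> z + bc_star (b z) * bc_bar (\<Psi> z))"
    using \<open>H \<in> R\<close> by (rule vekua_adjoint_rangeE)
  show "(\<lambda>z. G z + H z) \<in> R"
    by (rule vekua_adjoint_rangeI[of "\<lambda>z. \<Phi> z + \<Psi> z" "\<lambda>z. D z + E z"])
       (use G H in \<open>simp_all add: BW012_add BL2_add weak_bc_d_add BW012_BL2 bicomplex_eq_iff algebra_simps\<close>)
next
  fix c G assume "G \<in> R"
  then obtain \<Phi> D where G: "\<Phi> \<in> BW012" "D \<in> BL2" "weak_bc_d \<Omega> \<Phi> D"
    "G = (\<lambda>z. D z + bc_dagger (a z) * \<Phi> z + bc_star (b z) * bc_bar (\<Phi> z))"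
    by (rule vekua_adjoint_rangeE)
  show "(\<lambda>z. bc_of_complex c * G z) \<in> R"
    by (rule vekua_adjoint_rangeI[OF BW012_cmult[OF G(1), of c] BL2_cmult[OF G(2)] weak_bc_d_cmult[OF G(2,3)]])
       (simp add: G(4) bicomplex_eq_iff algebra_simps)
qed

section \<open>The Bergman space as an orthogonal complement\<close>

text \<open>The pointwise adjoint identity moves the coefficients from \<open>\<Phi>\<close> to
  \<open>W\<close>; what remains has the form of the weak equation.\<close>

lemma inner_vekua_adjoint:
  assumes W: "W \<in> BL2" and D: "D \<in> BL2" and \<Phi>: "\<Phi> \<in> BL2"
  shows "(\<integral>z. bc_pair (W z) \<bullet> bc_pair (D z + bc_dagger (a z) * \<Phi> z + bc_star (b z) * bc_bar (\<Phi> z)) \<partial>M)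
       = (\<integral>z. bc_pair (W z) \<bullet> bc_pair (D z) \<partial>M) + (\<integral>z. bc_pair (vekua_rhs W z) \<bullet> bc_pair (\<Phi> z) \<partial>M)"
proof -
  have "bc_pair (W z) \<bullet> bc_pair (D z + bc_dagger (a z) * \<Phi> z + bc_star (b z) * bc_bar (\<Phi> z))
      = bc_pair (W z) \<bullet> bc_pair (D z) + bc_pair (vekua_rhs W z) \<bullet> bc_pair (\<Phi> z)" for z
  proof -
    have "bc_inner (W z) (D z + X) = bc_inner (W z) (D z) + bc_inner (W z) X" for X
      by (simp add: bc_inner_def algebra_simps)
    then show ?thesis
      unfolding inner_bc_pair add.assoc by (simp only: bc_inner_adjoint plus_complex.sel)
  qed
  then show ?thesis
    using W D \<Phi> vekua_rhs_BL2[OF W] by (simp add: BL2_iff l2_inner_integrable)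
qed

lemma vekua_bergman_iff:
  "W \<in> vekua_bergman \<Omega> a b \<longleftrightarrow>
    W \<in> BL2 \<and> (\<forall>G\<in>R. (\<integral>z. bc_pair (W z) \<bullet> bc_pair (G z) \<partial>M) = 0)"
proof (cases "W \<in> BL2")
  case W: True
  note V = vekua_rhs_BL2[OF W]
  let ?I = "\<lambda>E \<Phi>. (\<integral>z. bc_pair (W z) \<bullet> bc_pair (E z) \<partial>M) + (\<integral>z. bc_pair (vekua_rhs W z) \<bullet> bc_pair (\<Phi> z) \<partial>M)"
  have weak: "W \<in> vekua_bergman \<Omega> a b \<longleftrightarrow> (\<forall>\<Phi>\<in>Btest. ?I (bc_d \<Phi>) \<Phi> = 0)"
    using W weak_bc_dbar_iff_orthogonal[OF W V] by (simp add: vekua_bergman_def)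
  have "(\<forall>\<Phi>\<in>Btest. ?I (bc_d \<Phi>) \<Phi> = 0) \<longleftrightarrow> (\<forall>G\<in>R. (\<integral>z. bc_pair (W z) \<bullet> bc_pair (G z) \<partial>M) = 0)"
  proof (intro iffI ballI)
    fix G assume test: "\<forall>\<Phi>\<in>Btest. ?I (bc_d \<Phi>) \<Phi> = 0" and "G \<in> R"
    from \<open>G \<in> R\<close> obtain \<Phi> D where G: "\<Phi> \<in> BW012" "D \<in> BL2" "weak_bc_d \<Omega> \<Phi> D"
      "G = (\<lambda>z. D z + bc_dagger (a z) * \<Phi> z + bc_star (b z) * bc_bar (\<Phi> z))"
      by (rule vekua_adjoint_rangeE)
    obtain \<Psi> where \<Psi>: "\<And>n. \<Psi> n \<in> Btest"
      "l2_tendsto M (\<lambda>n z. bc_pair (\<Psi> n z)) (\<lambda>z. bc_pair (\<Phi> z))"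
      "l2_tendsto M (\<lambda>n z. bc_pair (bc_d (\<Psi> n) z)) (\<lambda>z. bc_pair (D z))"
      using BW012_approx[OF G(1-3)] by blast
    \<comment> \<open>For fixed \<open>W\<close> the expression is L2-continuous in both arguments,
      so its vanishing on test functions passes to the limit.\<close>
    have "(\<lambda>n. ?I (bc_d (\<Psi> n)) (\<Psi> n)) \<longlonglongrightarrow> ?I D \<Phi>"
      using \<Psi>(2,3) W V unfolding l2_tendsto_def BL2_iff
      by (intro tendsto_add l2_inner_tendsto) auto
    then have "?I D \<Phi> = 0"
      using test \<Psi>(1) by (simp add: LIMSEQ_const_iff)
    then show "(\<integral>z. bc_pair (W z) \<bullet> bc_pair (G z) \<partial>M) = 0"
      unfolding G(4) by (subst inner_vekua_adjoint[OF W G(2) BW012_BL2[OF G(1)]])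
  next
    fix \<Phi> assume orth: "\<forall>G\<in>R. (\<integral>z. bc_pair (W z) \<bullet> bc_pair (G z) \<partial>M) = 0" and \<Phi>: "\<Phi> \<in> Btest"
    have "\<Phi> \<in> BW012"
      using \<Phi> by (simp add: bc_components_in_iff test_fun_W012)
    \<comment> \<open>Test functions supply members of the range, their classical derivative serving
      as the weak one.\<close>
    then have "(\<lambda>z. bc_d \<Phi> z + bc_dagger (a z) * \<Phi> z + bc_star (b z) * bc_bar (\<Phi> z)) \<in> R"
      by (rule vekua_adjoint_rangeI[OF _ Btest_d[OF \<Phi>] test_weak_bc_d[OF \<Phi>]]) simp
    from bspec[OF orth this] show "?I (bc_d \<Phi>) \<Phi> = 0"
      unfolding inner_vekua_adjoint[OF W Btest_d[OF \<Phi>] Btest_BL2[OF \<Phi>]] .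
  qed
  with weak W show ?thesis by simp
qed (simp add: vekua_bergman_def)

text \<open>Real orthogonality by itself yields real multiples only. As \<open>R\<close> is stable
  under \<open>\<i>\<close>, it upgrades to the Hermitian product, whose linearity in the first
  argument gives complex multiples.\<close>

lemma bc_L2_subspace_vekua_bergman: "bc_L2_subspace \<Omega> (vekua_bergman \<Omega> a b)"
proof -
  have cR: "(\<lambda>z. bc_of_complex c * G z) \<in> R" if "G \<in> R" for c G
    using bc_L2_subspace_vekua_adjoint_range that by (simp add: bc_L2_subspace_def)
  have iff: "W \<in> vekua_bergman \<Omega> a b \<longleftrightarrow> W \<in> BL2 \<and> (\<forall>G\<in>R. bc_L2_inner \<Omega> W G = 0)" for W
  proof
    assume W: "W \<in> vekua_bergman \<Omega> a b"
    then have "W \<in> BL2" by (simp add: vekua_bergman_iff)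
    moreover have "bc_L2_inner \<Omega> W G = 0" if "G \<in> R" for G
      using W that cR[OF that, of \<i>] vekua_adjoint_range_subset
      by (intro bc_L2_inner_eq_0I) (auto simp: vekua_bergman_iff)
    ultimately show "W \<in> BL2 \<and> (\<forall>G\<in>R. bc_L2_inner \<Omega> W G = 0)" by blast
  next
    assume "W \<in> BL2 \<and> (\<forall>G\<in>R. bc_L2_inner \<Omega> W G = 0)"
    then show "W \<in> vekua_bergman \<Omega> a b"
      using vekua_adjoint_range_subset by (auto simp: vekua_bergman_iff Re_bc_L2_inner[symmetric] subset_iff)
  qed
  have add: "bc_L2_inner \<Omega> (\<lambda>z. W z + V z) G = bc_L2_inner \<Omega> W G + bc_L2_inner \<Omega> V G"
    if "W \<in> BL2" "V \<in> BL2" "G \<in> BL2" for W V G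
    using bc_L2_inner_integrable[OF that(1,3)] bc_L2_inner_integrable[OF that(2,3)]
    unfolding bc_L2_inner_def
    by (subst Bochner_Integration.integral_add[symmetric]) (simp_all add: bc_inner_def algebra_simps)
  have cmult: "bc_L2_inner \<Omega> (\<lambda>z. bc_of_complex c * W z) G = c * bc_L2_inner \<Omega> W G" for c W G
    unfolding bc_L2_inner_def
    by (subst integral_mult_right_zero[symmetric]) (simp add: bc_inner_def algebra_simps)
  have RL: "G \<in> BL2" if "G \<in> R" for G
    using vekua_adjoint_range_subset that by blast
  show ?thesis
    unfolding bc_L2_subspace_def
  proof (intro conjI ballI allI subsetI)
    show "W \<in> BL2" if "W \<in> vekua_bergman \<Omega> a b" for W
      using that by (simp add: iff)
    show "(\<lambda>z. 0) \<in> vekua_bergman \<Omega> a b"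
      unfolding iff by (simp add: BL2_zero bc_L2_inner_def bc_inner_def)
    show "(\<lambda>z. W z + V z) \<in> vekua_bergman \<Omega> a b"
      if "W \<in> vekua_bergman \<Omega> a b" "V \<in> vekua_bergman \<Omega> a b" for W V
      using that unfolding iff by (simp add: BL2_add add RL)
    show "(\<lambda>z. bc_of_complex c * W z) \<in> vekua_bergman \<Omega> a b" if "W \<in> vekua_bergman \<Omega> a b" for c W
      using that unfolding iff by (simp add: BL2_cmult cmult)
  qed
qed

text \<open>By Cauchy-Schwarz the product with \<open>G\<close> is as small as the distance from
  \<open>G\<close> to \<open>R\<close> allows, hence 0.\<close>

lemma vekua_bergman_orthogonal_closure:
  assumes W: "W \<in> vekua_bergman \<Omega> a b" and G: "G \<in> bc_L2_closure \<Omega> R"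
  shows "(\<integral>z. bc_pair (W z) \<bullet> bc_pair (G z) \<partial>M) = 0"
proof -
  have WL: "(\<lambda>z. bc_pair (W z)) \<in> l2 M" and GL: "(\<lambda>z. bc_pair (G z)) \<in> l2 M"
    using W G by (auto simp: vekua_bergman_iff bc_L2_closure_def BL2_iff)
  let ?I = "\<bar>\<integral>z. bc_pair (W z) \<bullet> bc_pair (G z) \<partial>M\<bar>"
  let ?n = "l2_norm M (\<lambda>z. bc_pair (W z))"
  have "?I \<le> 0 + e" if "0 < e" for e
  proof -
    \<comment> \<open>Adding 1 avoids a separate case for \<open>W\<close> of norm 0.\<close>
    have n: "0 < ?n + 1" by (simp add: add_nonneg_pos)
    have "0 < e / (?n + 1)" using that n by simp
    then obtain H where H: "H \<in> R" "bc_L2_norm \<Omega> (\<lambda>z. G z - H z) < e / (?n + 1)"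
      using G unfolding bc_L2_closure_def by blast
    have HL: "(\<lambda>z. bc_pair (H z)) \<in> l2 M"
      using H vekua_adjoint_range_subset BL2_iff by blast
    have "(\<integral>z. bc_pair (W z) \<bullet> bc_pair (H z) \<partial>M) = 0"
      using W H by (simp add: vekua_bergman_iff)
    then have "(\<integral>z. bc_pair (W z) \<bullet> bc_pair (G z) \<partial>M) = (\<integral>z. bc_pair (W z) \<bullet> (bc_pair (G z) - bc_pair (H z)) \<partial>M)"
      by (simp add: inner_diff_right l2_inner_integrable WL GL HL)
    also have "\<bar>\<dots>\<bar> \<le> ?n * bc_L2_norm \<Omega> (\<lambda>z. G z - H z)"
      using l2_Cauchy_Schwarz[OF WL l2_diff[OF GL HL]] by (simp add: bc_L2_norm_eq bc_pair_simps)
    also have "\<dots> \<le> (?n + 1) * bc_L2_norm \<Omega> (\<lambda>z. G z - H z)"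
      by (intro mult_right_mono) (simp_all add: bc_L2_norm_eq)
    also have "\<dots> \<le> e"
      using H(2) unfolding pos_less_divide_eq[OF n] by (simp add: mult.commute)
    finally show ?thesis by simp
  qed
  then have "?I \<le> 0"
    by (rule field_le_epsilon)
  then show ?thesis by simp
qed

section \<open>The decomposition by projection\<close>

text \<open>\<open>H\<close> is the projection of \<open>F\<close> onto the closure of
  \<open>R\<close>, computed for pairs; the remainder is orthogonal to \<open>R\<close>, which
  characterizes the Bergman space.\<close>

lemma vekua_decomposition:
  assumes F: "F \<in> BL2"
  obtains H where "H \<in> bc_L2_closure \<Omega> R" and "(\<lambda>z. F z - H z) \<in> vekua_bergman \<Omega> a b"
proof -
  define P where "P = (\<lambda>G z. bc_pair (G z)) ` R"
  have sub: "bc_L2_subspace \<Omega> R" by (rule bc_L2_subspace_vekua_adjoint_range)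
  have PL: "P \<subseteq> l2 M"
    using vekua_adjoint_range_subset BL2_iff by (auto simp: P_def)
  have "(\<lambda>z. 0) \<in> R"
    using sub by (simp add: bc_L2_subspace_def)
  from imageI[OF this, of "\<lambda>G z. bc_pair (G z)"] have P0: "(\<lambda>z. 0) \<in> P"
    by (simp add: P_def bc_pair_simps)
  have Padd: "(\<lambda>z. G z + H z) \<in> P" if GH: "G \<in> P" "H \<in> P" for G H
  proof -
    obtain G' H' where "G' \<in> R" "H' \<in> R" and eq: "G = (\<lambda>z. bc_pair (G' z))" "H = (\<lambda>z. bc_pair (H' z))"
      using GH unfolding P_def by blast
    then have "(\<lambda>z. G' z + H' z) \<in> R"
      using sub by (simp add: bc_L2_subspace_def)
    then show ?thesis
      unfolding P_def eq bc_pair_simps(1)[symmetric] by (rule imageI)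
  qed
  have Pscale: "(\<lambda>z. r *\<^sub>R G z) \<in> P" if G: "G \<in> P" for r G
  proof -
    obtain G' where "G' \<in> R" and eq: "G = (\<lambda>z. bc_pair (G' z))"
      using G unfolding P_def by blast
    then have "(\<lambda>z. bc_of_complex (of_real r) * G' z) \<in> R"
      using sub by (simp add: bc_L2_subspace_def)
    then show ?thesis
      unfolding P_def eq bc_pair_simps(3)[symmetric] by (rule imageI)
  qed
  obtain h G where h: "h \<in> l2 M" and GP: "\<And>n::nat. G n \<in> P"
    and lim: "(\<lambda>n. l2_norm M (\<lambda>z. G n z - h z)) \<longlonglongrightarrow> 0"
    and orth: "\<And>K. K \<in> P \<Longrightarrow> (\<integral>z. (bc_pair (F z) - h z) \<bullet> K z \<partial>M) = 0"
    using l2_projection[OF finite_measure_M PL P0 Padd Pscale F[unfolded BL2_iff]] by blast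
  define H where "H z = Bicomplex (fst (h z)) (snd (h z))" for z
  have pH: "bc_pair (H z) = h z" for z
    by (simp add: H_def bc_pair_def)
  have HL: "H \<in> BL2" using h by (simp add: BL2_iff pH)
  have "H \<in> bc_L2_closure \<Omega> R"
    unfolding bc_L2_closure_def mem_Collect_eq
  proof (intro conjI HL allI impI)
    fix e :: real assume "0 < e"
    then obtain n where n: "l2_norm M (\<lambda>z. G n z - h z) < e"
      using order_tendstoD(2)[OF lim] by (auto simp: eventually_sequentially)
    obtain K where K: "K \<in> R" "G n = (\<lambda>z. bc_pair (K z))"
      using GP[of n] by (auto simp: P_def)
    have "bc_L2_norm \<Omega> (\<lambda>z. H z - K z) = l2_norm M (\<lambda>z. G n z - h z)"
      by (simp add: bc_L2_norm_eq bc_pair_simps pH K(2) l2_norm_def norm_minus_commute)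
    with K n show "\<exists>K\<in>R. bc_L2_norm \<Omega> (\<lambda>z. H z - K z) < e"
      by (intro bexI[of _ K]) simp_all
  qed
  moreover have "(\<lambda>z. F z - H z) \<in> vekua_bergman \<Omega> a b"
    unfolding vekua_bergman_iff
  proof (intro conjI ballI BL2_diff F HL)
    fix K assume "K \<in> R"
    then have "(\<lambda>z. bc_pair (K z)) \<in> P" by (auto simp: P_def)
    from orth[OF this] show "(\<integral>z. bc_pair (F z - H z) \<bullet> bc_pair (K z) \<partial>M) = 0"
      by (simp add: bc_pair_simps pH)
  qed
  ultimately show ?thesis by (rule that)
qed

lemma vekua_orthogonal_decomposition:
  "bc_L2_orthogonal_decomposition \<Omega> (vekua_bergman \<Omega> a b) (bc_L2_closure \<Omega> R)"
  unfolding bc_L2_orthogonal_decomposition_def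
proof (intro conjI ballI)
  show "bc_L2_subspace \<Omega> (vekua_bergman \<Omega> a b)"
    by (rule bc_L2_subspace_vekua_bergman)
  show N: "bc_L2_subspace \<Omega> (bc_L2_closure \<Omega> R)"
    by (rule bc_L2_subspace_closure[OF bc_L2_subspace_vekua_adjoint_range])
  fix W G assume W: "W \<in> vekua_bergman \<Omega> a b" and G: "G \<in> bc_L2_closure \<Omega> R"
  \<comment> \<open>The closure is stable under \<open>\<i>\<close>, so real orthogonality also
    makes the imaginary part of the product vanish.\<close>
  have "(\<lambda>z. bc_of_complex \<i> * G z) \<in> bc_L2_closure \<Omega> R"
    using N G by (simp add: bc_L2_subspace_def)
  moreover have "W \<in> BL2" "G \<in> BL2"
    using W G by (auto simp: vekua_bergman_def bc_L2_closure_def)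
  ultimately show "bc_L2_inner \<Omega> W G = 0"
    by (intro bc_L2_inner_eq_0I vekua_bergman_orthogonal_closure W G)
next
  fix F assume "F \<in> BL2"
  then obtain H where H: "H \<in> bc_L2_closure \<Omega> R" "(\<lambda>z. F z - H z) \<in> vekua_bergman \<Omega> a b"
    by (rule vekua_decomposition)
  have "AE z in M. F z = (F z - H z) + H z" by simp
  with H show "\<exists>G\<in>vekua_bergman \<Omega> a b. \<exists>H\<in>bc_L2_closure \<Omega> R. AE z in M. F z = G z + H z"
    by (intro bexI[of _ "\<lambda>z. F z - H z"] bexI[of _ H])
qed

end

theorem proposition34:
  fixes \<Omega> :: "complex set" and a b :: "complex \<Rightarrow> bicomplex"
  assumes "open \<Omega>" and "connected \<Omega>" and "\<Omega> \<noteq> {}" and "bounded \<Omega>"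
    and "simply_connected \<Omega>"
    and "liapunov_curve (frontier \<Omega>)"
    and "a \<in> bc_components_in (Linf_fun \<Omega>)"
    and "b \<in> bc_components_in (Linf_fun \<Omega>)"
  shows "bc_L2_orthogonal_decomposition \<Omega>
           (vekua_bergman \<Omega> a b)
           (bc_L2_closure \<Omega> (vekua_adjoint_range \<Omega> a b))"
proof -
  interpret vekua_coefficients \<Omega> a b
    by unfold_locales (use assms in auto)
  show ?thesis
    by (rule vekua_orthogonal_decomposition)
qed

end
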